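(* Suppose: (A) $f$ is path-differentiable with convex-valued conservative field $\mathcal D_f$; $c$ is path-differentiable with convex-valued conservative Jacobian $\mathcal D_c$; and $\inf_{x\in\mathcal X}f(x)>-\infty$. (B) The set $\{g(x): x\in\mathcal X,\ 0\in\mathcal D_g(x)+\mathcal N_{\mathcal X}(x)\}$ has empty interior in $\mathbb R$. (C) For the method (SGD-LALM) described in the context: (1) $\{x_k\}\subset\mathcal X$ is uniformly bounded; (2) there is a nonnegative sequence $\{\delta_k\}$ with $\lim_k\delta_k=0$ such that $d_k\in\mathcal D_f^{\delta_k}(x_k)$, $J_{c,k}\in\mathcal D_c^{\delta_k}(x_k)$ and $\|w_k-c(x_k)\|\le\delta_k$ for all $k\ge0$; (3) $\{\xi_k\}$ is uniformly bounded, $\eta_k>0$, $\lim_k\eta_k=0$, $\sum_{k=0}^\infty\eta_k=+\infty$, and for every $T>0$, $\lim_{i\to\infty}\sup_{i\le j\le\Lambda(\sigma_i+T)}\big\|\sum_{k=i}^j\eta_k\xi_{k+1}\big\|=0$; (4) there exist $0<\theta_{\min}\le\theta_{\max}<\beta$ with $\theta_{\min}\le\theta_k\le\theta_{\max}$ for all $k\ge0$. Then for any sequence $\{x_k\}$ generated by (SGD-LALM), any cluster point of $\{x_k\}$ lies in $\{x\in\mathcal X:0\in\mathcal D_g(x)+\mathcal N_{\mathcal X}(x)\}$, and the sequence $\{g(x_k)\}$ converges. Moreover, if in addition there is $\nu>0$ with $\nu\|c(x)\|\le\mathrm{dist}(-\mathcal D_c(x)c(x),\mathcal N_{\mathcal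 X}(x))$ for all $x\in\mathcal X$, $f$ is $M_f$-Lipschitz continuous, and $\beta>\frac{M_f}{\nu}$ in (SGD-LALM), then any cluster point of $\{x_k\}$ is a $(\mathcal D_f,\mathcal D_c)$-KKT point of $\min_{x\in\mathcal X}f(x)$ s.t. $c(x)=0$, and the sequence $\{f(x_k)\}$ converges.
   Context: Setting: $\mathcal X\subseteq\mathbb R^n$ is a closed convex set, $f:\mathbb R^n\to\mathbb R$ and $c:\mathbb R^n\to\mathbb R^p$ are locally Lipschitz. $\mathcal N_{\mathcal X}(x)$ is the normal cone of $\mathcal X$ at $x\in\mathcal X$; $\mathrm{prox}_{\mathcal X}(x)=\arg\min_{y\in\mathcal X}\|y-x\|^2$; $\mathrm{dist}$ between two sets (or a set and a point) is the infimum of distances between their elements. Conservative Jacobian: for a locally Lipschitz $H:\mathbb R^n\to\mathbb R^s$, a set-valued $\mathcal D_H:\mathbb R^n\rightrightarrows\mathbb R^{n\times s}$ that is nonempty-valued, locally bounded, graph-closed, and such that for every absolutely continuous curve $\gamma:\mathbb R_+\to\mathbb R^n$, for almost every $t$, $\frac{d(H\circ\gamma)}{dt}(t)=J^\top\dot\gamma(t)$ for all $J\in\mathcal D_H(\gamma(t))$. For $s=1$ it is called a conservative field. $H$ is path-differentiable if it is locally Lipschitz and admits a conservative Jacobian. KKT point: $x\in\mathcal X$ is a $(\mathcal D_f,\mathcal D_c)$-KKT point if $c(x)=0$ and $0\in\mathcal D_f(x)+\mathrm{span}(\mathcal D_c(x))+\mathcal N_{\mathcal X}(x)$, where for $\mathcal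 Z\subseteq\mathbb R^{n\times p}$, $\mathrm{span}(\mathcal Z)$ is the smallest linear subspace of $\mathbb R^n$ containing $\{Z\lambda:Z\in\mathcal Z,\lambda\in\mathbb R^p\}$. $\delta$-expansion: $\mathcal D^\delta(x)=\{w:\exists z,\ \|z-x\|\le\delta,\ \mathrm{dist}(w,\mathcal D(z))\le\delta\}$. For positive stepsizes $\{\eta_k\}$: $\sigma_0=0$, $\sigma_i=\sum_{k=0}^{i-1}\eta_k$, $\Lambda(t)=\sup\{k\ge0:\sigma_k\le t\}$. Parameters $\beta>0$, $\rho\ge0$. $\mathrm{regu}(y)=y/\|y\|$ if $y\ne0$ and $\mathrm{regu}(0)=0$. $\mathcal T_{regu}(y)=\{y/\|y\|\}$ if $y\neq0$ and $\mathcal T_{regu}(0)=\{u\in\mathbb R^p:\|u\|\le1\}$. $g(x)=f(x)+\beta\|c(x)\|+\frac\rho2\|c(x)\|^2$, $\mathcal D_g(x)=\mathrm{conv}\big(\mathcal D_f(x)+\mathcal D_c(x)(\beta\mathcal T_{regu}(c(x))+\rho c(x))\big)$, where $\mathcal W\mathcal Y=\{Wy:W\in\mathcal W,y\in\mathcal Y\}$; $\mathcal D_g$ is a convex-valued conservative field of $g$. Method (SGD-LALM): starting from some $x_0\in\mathcal X$, $w_0,\lambda_0\in\mathbb R^p$, for $k\ge0$: $l_{x,k}=d_k+J_{c,k}(\lambda_k+\rho w_k)+\xi_{k+1}$; $x_{k+1}=\mathrm{prox}_{\mathcal X}(x_k-\eta_kl_{x,k})$; $w_{k+1}\in\mathbb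 R^p$ is an approximate evaluation of $c(x_{k+1})$; $\lambda_{k+1}=\lambda_k+\theta_k(\mathrm{regu}(w_{k+1})-\frac1\beta\lambda_k)$. Here $d_k\in\mathbb R^n$, $J_{c,k}\in\mathbb R^{n\times p}$, $\xi_{k+1}\in\mathbb R^n$.
   Formalization: In the "moreover" part it is additionally assumed that every element of D_f(x), x in X, has norm at most M_f; for M_f-Lipschitz f with an arbitrary convex-valued conservative field the claim is false (it is automatic for the Clarke subdifferential). *)

theory Defs
  imports "HOL-Analysis.Analysis" "HOL-Library.Set_Algebras"
begin

text \<open>
  Conventions: an n x p matrix is an element of \<open>real^'p^'n\<close>, and \<open>A + B\<close> on sets is the
  Minkowski sum. The projection onto a nonempty closed convex set is the library's
  \<open>closest_point\<close>, minimising the distance, equivalently its square.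
\<close>

definition locally_lipschitz :: "('a::metric_space \<Rightarrow> 'b::metric_space) \<Rightarrow> bool" where
  "locally_lipschitz H \<longleftrightarrow> (\<forall>x. \<exists>r>0. \<exists>L. L-lipschitz_on (ball x r) H)"

definition absolutely_continuous_interval ::
    "real \<Rightarrow> real \<Rightarrow> (real \<Rightarrow> 'a::real_normed_vector) \<Rightarrow> bool" where
  "absolutely_continuous_interval a b \<gamma> \<longleftrightarrow>
     (\<forall>\<epsilon>>0. \<exists>\<delta>>0. \<forall>(N::nat) s t.
        (\<forall>i<N. a \<le> s i \<and> s i \<le> t i \<and> t i \<le> b) \<longrightarrow>
        disjoint_family_on (\<lambda>i. {s i<..<t i}) {..<N} \<longrightarrow>
        (\<Sum>i<N. t i - s i) < \<delta> \<longrightarrow>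
        (\<Sum>i<N. norm (\<gamma> (t i) - \<gamma> (s i))) < \<epsilon>)"

text \<open>
  A curve on the half-line is absolutely continuous when it is so on every compact subinterval.
  Its values at negative arguments are irrelevant.
\<close>

definition absolutely_continuous_curve :: "(real \<Rightarrow> 'a::real_normed_vector) \<Rightarrow> bool" where
  "absolutely_continuous_curve \<gamma> \<longleftrightarrow> (\<forall>b\<ge>0. absolutely_continuous_interval 0 b \<gamma>)"

definition locally_bounded_map ::
    "('a::metric_space \<Rightarrow> 'm::metric_space set) \<Rightarrow> bool" where
  "locally_bounded_map D \<longleftrightarrow> (\<forall>x. \<exists>r>0. bounded (\<Union>y\<in>ball x r. D y))"

definition graph_closed :: "('a::topological_space \<Rightarrow> 'm::topological_space set) \<Rightarrow> bool" where
  "graph_closed D \<longleftrightarrow> closed {(x, J). J \<in> D x}"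

text \<open>
  The common part of conservative Jacobians and conservative fields; \<open>app J v\<close> is the action
  of \<open>J\<close> on a velocity \<open>v\<close>, i.e. the product of the transpose of \<open>J\<close> with \<open>v\<close>.
\<close>

definition conservative_map ::
    "('m::metric_space \<Rightarrow> 'a::real_normed_vector \<Rightarrow> 'b::real_normed_vector) \<Rightarrow>
     ('a \<Rightarrow> 'b) \<Rightarrow> ('a \<Rightarrow> 'm set) \<Rightarrow> bool" where
  "conservative_map app H D \<longleftrightarrow>
     (\<forall>x. D x \<noteq> {}) \<and> locally_bounded_map D \<and> graph_closed D \<and>
     (\<forall>\<gamma>. absolutely_continuous_curve \<gamma> \<longrightarrow>
        (AE t in lebesgue_on {0..}.
           \<exists>v. (\<gamma> has_vector_derivative v) (at t within {0..}) \<and>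
             (\<forall>J\<in>D (\<gamma> t). ((H \<circ> \<gamma>) has_vector_derivative app J v) (at t within {0..}))))"

definition conservative_jacobian ::
    "(real^'n \<Rightarrow> real^'s) \<Rightarrow> (real^'n \<Rightarrow> (real^'s^'n) set) \<Rightarrow> bool" where
  "conservative_jacobian H D \<longleftrightarrow>
     locally_lipschitz H \<and> conservative_map (\<lambda>J v. transpose J *v v) H D"

text \<open>The case of a scalar function, with n x 1 matrices identified with vectors.\<close>

definition conservative_field ::
    "(real^'n \<Rightarrow> real) \<Rightarrow> (real^'n \<Rightarrow> (real^'n) set) \<Rightarrow> bool" where
  "conservative_field h D \<longleftrightarrow>
     locally_lipschitz h \<and> conservative_map (\<lambda>d v. d \<bullet> v) h D"

definition normal_cone :: "'a::real_inner set \<Rightarrow> 'a \<Rightarrow> 'a set" where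
  "normal_cone X x = {v. \<forall>y\<in>X. v \<bullet> (y - x) \<le> 0}"

definition column_span :: "(real^'p^'n) set \<Rightarrow> (real^'n) set" where
  "column_span Z = span {J *v \<mu> |J \<mu>. J \<in> Z}"

definition kkt_point ::
    "(real^'n) set \<Rightarrow> (real^'n \<Rightarrow> real^'p) \<Rightarrow> (real^'n \<Rightarrow> (real^'n) set) \<Rightarrow>
     (real^'n \<Rightarrow> (real^'p^'n) set) \<Rightarrow> real^'n \<Rightarrow> bool" where
  "kkt_point X c Df Dc x \<longleftrightarrow>
     x \<in> X \<and> c x = 0 \<and> 0 \<in> Df x + column_span (Dc x) + normal_cone X x"

definition expansion ::
    "real \<Rightarrow> ('a::real_normed_vector \<Rightarrow> 'm::metric_space set) \<Rightarrow> 'a \<Rightarrow> 'm set" where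
  "expansion \<delta> D x = {w. \<exists>z. norm (z - x) \<le> \<delta> \<and> infdist w (D z) \<le> \<delta>}"

definition step_time :: "(nat \<Rightarrow> real) \<Rightarrow> nat \<Rightarrow> real" where
  "step_time \<eta> i = (\<Sum>k<i. \<eta> k)"

text \<open>For positive step sizes with divergent sum and \<open>t \<ge> 0\<close> the set below is finite and nonempty.\<close>

definition step_index :: "(nat \<Rightarrow> real) \<Rightarrow> real \<Rightarrow> nat" where
  "step_index \<eta> t = Sup {k. step_time \<eta> k \<le> t}"

definition regu :: "'a::real_normed_vector \<Rightarrow> 'a" where
  "regu y = (if y = 0 then 0 else y /\<^sub>R norm y)"

definition T_regu :: "'a::real_normed_vector \<Rightarrow> 'a set" where
  "T_regu y = (if y = 0 then {u. norm u \<le> 1} else {y /\<^sub>R norm y})"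

definition penalty ::
    "(real^'n \<Rightarrow> real) \<Rightarrow> (real^'n \<Rightarrow> real^'p) \<Rightarrow> real \<Rightarrow> real \<Rightarrow> real^'n \<Rightarrow> real" where
  "penalty f c \<beta> \<rho> x = f x + \<beta> * norm (c x) + \<rho> / 2 * (norm (c x))\<^sup>2"

definition penalty_field ::
    "(real^'n \<Rightarrow> (real^'n) set) \<Rightarrow> (real^'n \<Rightarrow> real^'p) \<Rightarrow> (real^'n \<Rightarrow> (real^'p^'n) set) \<Rightarrow>
     real \<Rightarrow> real \<Rightarrow> real^'n \<Rightarrow> (real^'n) set" where
  "penalty_field Df c Dc \<beta> \<rho> x =
     convex hull (Df x + {J *v (\<beta> *\<^sub>R u + \<rho> *\<^sub>R c x) |J u. J \<in> Dc x \<and> u \<in> T_regu (c x)})"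

definition critical_set ::
    "'a::real_inner set \<Rightarrow> ('a \<Rightarrow> 'a set) \<Rightarrow> 'a set" where
  "critical_set X D = {x\<in>X. 0 \<in> D x + normal_cone X x}"

text \<open>
  The sequence \<open>w\<close> is unrestricted here; how well \<open>w k\<close> approximates \<open>c (x k)\<close> is a separate
  assumption on the iteration, as is the choice of \<open>d\<close> and \<open>J\<close>.
\<close>

definition sgd_lalm ::
    "(real^'n) set \<Rightarrow> real \<Rightarrow> real \<Rightarrow> (nat \<Rightarrow> real) \<Rightarrow> (nat \<Rightarrow> real) \<Rightarrow>
     (nat \<Rightarrow> real^'n) \<Rightarrow> (nat \<Rightarrow> real^'p^'n) \<Rightarrow> (nat \<Rightarrow> real^'n) \<Rightarrow>
     (nat \<Rightarrow> real^'n) \<Rightarrow> (nat \<Rightarrow> real^'p) \<Rightarrow> (nat \<Rightarrow> real^'p) \<Rightarrow> bool" where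
  "sgd_lalm X \<beta> \<rho> \<eta> \<theta> d J \<xi> x w \<mu> \<longleftrightarrow>
     x 0 \<in> X \<and>
     (\<forall>k. x (Suc k) =
        closest_point X (x k - \<eta> k *\<^sub>R (d k + J k *v (\<mu> k + \<rho> *\<^sub>R w k) + \<xi> (Suc k)))) \<and>
     (\<forall>k. \<mu> (Suc k) = \<mu> k + \<theta> k *\<^sub>R (regu (w (Suc k)) - (1 / \<beta>) *\<^sub>R \<mu> k))"

definition cluster_point :: "(nat \<Rightarrow> 'a::topological_space) \<Rightarrow> 'a \<Rightarrow> bool" where
  "cluster_point x a \<longleftrightarrow> (\<exists>r. strict_mono r \<and> (x \<circ> r) \<longlonglongrightarrow> a)"

end

theory Submission
  imports Defs "HOL-Complex_Analysis.Great_Picard"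
begin

text \<open>
  The method is a noisy Euler scheme for the differential inclusion \<open>x' \<in> - Q x\<close> with
  \<open>Q = D\<^sub>g + N\<^sub>X\<close>, the sum of the penalty field and the normal cone, and the penalty function \<open>g\<close> is a
  Lyapunov function for this inclusion.

  That the scheme discretises the inclusion rests on two observations. The projection onto \<open>X\<close>
  contributes a bounded element of the normal cone at the next iterate. The multiplier forgets its
  past geometrically while the iterates move by vanishing amounts, so along iterates converging to
  \<open>a\<close> it approaches \<open>\<beta>\<close> times the subdifferential of the norm at \<open>c a\<close> (\<open>multiplier_limit\<close>).
  Together with the closed graphs of the conservative maps this shows that limits of search
  directions at \<open>a\<close> belong to \<open>Q a\<close>. By Arzela--Ascoli the interpolated iterates have limit curves
  (\<open>limit_curve\<close>), and a separating hyperplane argument shows that these solve the inclusion wherever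
  they are differentiable (\<open>limit_inclusion\<close>).

  Along a solution \<open>\<gamma>\<close> in \<open>X\<close> the chain rule for conservative maps (\<open>penalty_chain_rule\<close>) and the
  orthogonality of normal vectors to the velocity give \<open>(g \<circ> \<gamma>)' = - (norm \<gamma>')\<^sup>2\<close> almost everywhere, so
  \<open>g\<close> strictly decreases unless \<open>\<gamma>\<close> starts at a critical point (\<open>descent\<close>). Since the critical values
  contain no interval, oscillating values of \<open>g\<close> would have to climb infinitely often from a
  noncritical level, against this descent; hence they converge (\<open>lyapunov_values_converge\<close>), and then
  limit curves started at cluster points cannot decrease \<open>g\<close>, which forces cluster points to be
  critical (\<open>cluster_points_critical\<close>). Under the error bound on the constraint, a large penalty
  parameter excludes infeasible critical points, and the feasible ones are KKT points
  (\<open>critical_point_is_kkt\<close>).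
\<close>

section \<open>Locally Lipschitz functions and almost everywhere derivatives\<close>

lemma locally_lipschitz_continuous:
  assumes "locally_lipschitz H"
  shows "continuous_on UNIV H"
proof -
  have "isCont H x" for x
  proof -
    obtain r L where "r > 0" "L-lipschitz_on (ball x r) H"
      using assms unfolding locally_lipschitz_def by blast
    then have "continuous_on (ball x r) H"
      using lipschitz_on_continuous_on by blast
    then show ?thesis
      using \<open>r > 0\<close> by (simp add: continuous_on_eq_continuous_at)
  qed
  then show ?thesis
    by (simp add: continuous_at_imp_continuous_on)
qed

lemma lipschitz_imp_locally_lipschitz:
  assumes "L-lipschitz_on UNIV H"
  shows "locally_lipschitz H"
  unfolding locally_lipschitz_def
  using lipschitz_on_subset[OF assms subset_UNIV] zero_less_one by blast

lemma locally_lipschitz_compose: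
  fixes G :: "'b::metric_space \<Rightarrow> 'c::metric_space" and H :: "'a::metric_space \<Rightarrow> 'b"
  assumes "locally_lipschitz G" "locally_lipschitz H"
  shows "locally_lipschitz (G \<circ> H)"
  unfolding locally_lipschitz_def
proof
  fix x
  obtain r L where r: "r > 0" "L-lipschitz_on (ball x r) H"
    using assms(2) unfolding locally_lipschitz_def by blast
  obtain s M where s: "s > 0" "M-lipschitz_on (ball (H x) s) G"
    using assms(1) unfolding locally_lipschitz_def by blast
  have "isCont H x"
    using locally_lipschitz_continuous[OF assms(2)] by (simp add: continuous_on_eq_continuous_at)
  then obtain q where q: "q > 0" "\<And>y. dist x y < q \<Longrightarrow> dist (H x) (H y) < s"
    using s(1) unfolding continuous_at_eps_delta by (metis dist_commute)
  have "H ` ball x (min r q) \<subseteq> ball (H x) s"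
    using q by auto
  then have "(M * L)-lipschitz_on (ball x (min r q)) (G \<circ> H)"
    by (intro lipschitz_on_compose lipschitz_on_subset[OF r(2)] lipschitz_on_subset[OF s(2)]) auto
  then show "\<exists>r>0. \<exists>L. L-lipschitz_on (ball x r) (G \<circ> H)"
    using r(1) q(1) by (meson min_less_iff_conj)
qed

lemma locally_lipschitz_add:
  fixes G H :: "'a::metric_space \<Rightarrow> 'b::real_normed_vector"
  assumes "locally_lipschitz G" "locally_lipschitz H"
  shows "locally_lipschitz (\<lambda>x. G x + H x)"
  unfolding locally_lipschitz_def
proof
  fix x
  obtain r L where r: "r > 0" "L-lipschitz_on (ball x r) H"
    using assms(2) unfolding locally_lipschitz_def by blast
  obtain s M where s: "s > 0" "M-lipschitz_on (ball x s) G"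
    using assms(1) unfolding locally_lipschitz_def by blast
  have "(M + L)-lipschitz_on (ball x (min r s)) (\<lambda>x. G x + H x)"
    by (intro lipschitz_on_add lipschitz_on_subset[OF r(2)] lipschitz_on_subset[OF s(2)]) auto
  then show "\<exists>r>0. \<exists>L. L-lipschitz_on (ball x r) (\<lambda>x. G x + H x)"
    using r(1) s(1) by (meson min_less_iff_conj)
qed

lemma locally_lipschitz_cmult_power2_norm:
  "locally_lipschitz (\<lambda>y::'a::real_normed_vector. a * (norm y)\<^sup>2)"
  unfolding locally_lipschitz_def
proof
  fix x :: 'a
  let ?K = "2 * (norm x + 1)"
  have "\<bar>a * (norm y)\<^sup>2 - a * (norm z)\<^sup>2\<bar> \<le> \<bar>a\<bar> * ?K * dist y z"
    if "y \<in> ball x 1" "z \<in> ball x 1" for y z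
  proof -
    have "norm y \<le> norm x + 1" "norm z \<le> norm x + 1"
      using that norm_triangle_ineq2[of y x] norm_triangle_ineq2[of z x]
      by (auto simp: dist_norm norm_minus_commute)
    then have "\<bar>norm y + norm z\<bar> * \<bar>norm y - norm z\<bar> \<le> ?K * norm (y - z)"
      by (intro mult_mono) (auto simp: norm_triangle_ineq3)
    then have "\<bar>a\<bar> * (\<bar>norm y + norm z\<bar> * \<bar>norm y - norm z\<bar>) \<le> \<bar>a\<bar> * (?K * norm (y - z))"
      by (intro mult_left_mono) auto
    moreover have "\<bar>a * (norm y)\<^sup>2 - a * (norm z)\<^sup>2\<bar> = \<bar>a\<bar> * (\<bar>norm y + norm z\<bar> * \<bar>norm y - norm z\<bar>)"
      unfolding abs_mult[symmetric] by (simp add: algebra_simps power2_eq_square)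
    ultimately show ?thesis
      by (simp add: dist_norm mult.assoc)
  qed
  then have "(\<bar>a\<bar> * ?K)-lipschitz_on (ball x 1) (\<lambda>y. a * (norm y)\<^sup>2)"
    by (intro lipschitz_onI) (auto simp: dist_real_def)
  then show "\<exists>r>0. \<exists>L. L-lipschitz_on (ball x r) (\<lambda>y. a * (norm y)\<^sup>2)"
    using zero_less_one by blast
qed

text \<open>
  A locally Lipschitz function maps null sets to null sets, so if the function rose strictly, almost
  every level crossed on the way up would be free of exceptional points; at the last visit to such a
  level the derivative would have to be nonnegative. Tilting by \<open>\<epsilon>\<close> makes the derivative strictly
  negative and rules this out. This stands in for the fundamental theorem of calculus for absolutely
  continuous functions: along the limit curves only monotonicity and constancy matter.
\<close>

lemma locally_lipschitz_nonincreasing: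
  fixes h :: "real \<Rightarrow> real"
  assumes h: "locally_lipschitz h" and N: "negligible N" and "a \<le> b"
    and deriv: "\<And>t. a < t \<Longrightarrow> t < b \<Longrightarrow> t \<notin> N \<Longrightarrow> \<exists>D\<le>0. (h has_real_derivative D) (at t)"
  shows "h b \<le> h a"
proof -
  have "h b - \<epsilon> * b \<le> h a - \<epsilon> * a" if "\<epsilon> > 0" for \<epsilon>
  proof (rule ccontr)
    define \<phi> where "\<phi> t = h t - \<epsilon> * t" for t
    assume "\<not> ?thesis"
    then have less: "\<phi> a < \<phi> b"
      by (simp add: \<phi>_def)
    have "locally_lipschitz (\<lambda>t. h t + (- \<epsilon>) *\<^sub>R t)"
      by (intro locally_lipschitz_add h
          lipschitz_imp_locally_lipschitz[OF lipschitz_on_cmult[OF lipschitz_on_id]])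
    then have \<phi>: "locally_lipschitz \<phi>"
      by (simp add: \<phi>_def[abs_def])
    have "negligible (\<phi> ` N)"
    proof (rule negligible_locally_Lipschitz_image)
      fix t
      obtain r L where "r > 0" "L-lipschitz_on (ball t r) \<phi>"
        using \<phi> unfolding locally_lipschitz_def by blast
      then show "\<exists>T B. open T \<and> t \<in> T \<and> (\<forall>y\<in>N \<inter> T. norm (\<phi> y - \<phi> t) \<le> B * norm (y - t))"
        by (intro exI[of _ "ball t r"] exI[of _ L]) (auto simp: lipschitz_on_def dist_norm)
    qed (use N in auto)
    moreover have "\<not> negligible {\<phi> a<..<\<phi> b}"
      using less negligible_interval(2)[of "\<phi> a" "\<phi> b"] by (simp add: box_real)
    ultimately have "\<not> {\<phi> a<..<\<phi> b} \<subseteq> \<phi> ` N"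
      using negligible_subset by blast
    then obtain y where "y \<in> {\<phi> a<..<\<phi> b}" "y \<notin> \<phi> ` N"
      by blast
    then have y: "\<phi> a < y" "y < \<phi> b" "y \<notin> \<phi> ` N"
      by simp_all
    define S where "S = {a..b} \<inter> \<phi> -` {..y}"
    have cont: "continuous_on UNIV \<phi>"
      by (rule locally_lipschitz_continuous[OF \<phi>])
    have "closed S"
      unfolding S_def by (intro closed_Int closed_vimage[OF _ cont] closed_atLeastAtMost closed_atMost)
    moreover have S: "a \<in> S" "bdd_above S" "S \<subseteq> {a..b}"
      using y \<open>a \<le> b\<close> by (auto simp: S_def)
    ultimately have "Sup S \<in> S"
      using closed_contains_Sup by blast
    \<comment> \<open>After its last visit to a level \<open>y\<close> below \<open>\<phi> b\<close>, the function \<open>\<phi>\<close> stays above \<open>y\<close>; but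
      that visit takes place where the derivative of \<open>\<phi>\<close> is negative.\<close>
    define t where "t = Sup S"
    have t: "a \<le> t" "t \<le> b" "\<phi> t \<le> y"
      using \<open>Sup S \<in> S\<close> by (auto simp: t_def S_def)
    have above: "\<phi> s > y" if "t < s" "s \<le> b" for s
      using that cSup_upper[OF _ S(2), of s] t by (force simp: S_def t_def)
    have "t < b"
      using t y(2) by (cases "t = b") auto
    have "\<phi> t = y"
    proof (rule ccontr)
      assume "\<phi> t \<noteq> y"
      then have "\<phi> t < y"
        using t by auto
      then obtain s where "t \<le> s" "s \<le> b" "\<phi> s = y"
        using IVT'[of \<phi> t y b] y(2) t continuous_on_subset[OF cont] by auto
      then show False
        using above[of s] \<open>\<phi> t \<noteq> y\<close> by (cases "s = t") auto
    qed
    then have "a < t" "t \<notin> N"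
      using y t by (auto simp: order_le_less)
    then obtain D where "D \<le> 0" "(h has_real_derivative D) (at t)"
      using deriv \<open>t < b\<close> by blast
    then have "(\<phi> has_real_derivative (D - \<epsilon>)) (at t)" "D - \<epsilon> < 0"
      unfolding \<phi>_def using \<open>\<epsilon> > 0\<close> by (auto intro!: derivative_eq_intros)
    then obtain \<delta> where "\<delta> > 0" "\<And>k. 0 < k \<Longrightarrow> k < \<delta> \<Longrightarrow> \<phi> (t + k) < \<phi> t"
      using DERIV_neg_dec_right by blast
    then show False
      using above[of "t + min (\<delta> / 2) (b - t)"] \<open>\<phi> t = y\<close> \<open>t < b\<close>
      by (smt (verit, best) field_sum_of_halves min_def)
  qed
  then have *: "h b \<le> h a + \<epsilon> * (b - a)" if "\<epsilon> > 0" for \<epsilon>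
    using that by (force simp: algebra_simps)
  show ?thesis
  proof (rule field_le_epsilon)
    fix e :: real assume "e > 0"
    then have "h b \<le> h a + e / (b - a + 1) * (b - a)"
      using \<open>a \<le> b\<close> by (intro *) simp
    also have "e / (b - a + 1) * (b - a) \<le> e"
      using \<open>e > 0\<close> \<open>a \<le> b\<close> by (simp add: field_simps)
    finally show "h b \<le> h a + e"
      by simp
  qed
qed

lemma lipschitz_curve_constant:
  fixes \<gamma> :: "real \<Rightarrow> 'a::real_inner"
  assumes \<gamma>: "L-lipschitz_on UNIV \<gamma>" and N: "negligible N" and "a \<le> b"
    and deriv: "\<And>t. a < t \<Longrightarrow> t < b \<Longrightarrow> t \<notin> N \<Longrightarrow> (\<gamma> has_vector_derivative 0) (at t)"
  shows "\<gamma> b = \<gamma> a"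
proof -
  define u where "u = \<gamma> b - \<gamma> a"
  have "(norm u * L)-lipschitz_on UNIV (\<lambda>t. u \<bullet> \<gamma> t)"
  proof (rule lipschitz_onI)
    fix s t
    have "\<bar>u \<bullet> (\<gamma> s - \<gamma> t)\<bar> \<le> norm u * norm (\<gamma> s - \<gamma> t)"
      by (rule Cauchy_Schwarz_ineq2)
    also have "\<dots> \<le> norm u * (L * dist s t)"
      using \<gamma> by (intro mult_left_mono) (auto simp: lipschitz_on_def dist_norm)
    finally show "dist (u \<bullet> \<gamma> s) (u \<bullet> \<gamma> t) \<le> norm u * L * dist s t"
      by (simp add: dist_real_def inner_diff_right)
  qed (use lipschitz_on_nonneg[OF \<gamma>] in auto)
  then have "u \<bullet> \<gamma> b \<le> u \<bullet> \<gamma> a"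
  proof (rule locally_lipschitz_nonincreasing[OF lipschitz_imp_locally_lipschitz N \<open>a \<le> b\<close>])
    fix t assume "a < t" "t < b" "t \<notin> N"
    then have "(\<gamma> has_derivative (\<lambda>_. 0)) (at t)"
      using deriv by (auto simp: has_vector_derivative_def)
    then have "((\<lambda>t. u \<bullet> \<gamma> t) has_derivative (\<lambda>_. u \<bullet> 0)) (at t)"
      by (rule has_derivative_inner_right)
    then have "((\<lambda>t. u \<bullet> \<gamma> t) has_real_derivative 0) (at t)"
      unfolding has_field_derivative_def by (rule has_derivative_eq_rhs) auto
    then show "\<exists>D\<le>0. ((\<lambda>t. u \<bullet> \<gamma> t) has_real_derivative D) (at t)"
      by blast
  qed
  then have "u \<bullet> u \<le> 0"
    by (simp add: u_def inner_diff_right)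
  then show ?thesis
    using inner_gt_zero_iff[of u] by (fastforce simp: u_def simp del: inner_gt_zero_iff)
qed

lemma countable_isolated_points:
  fixes S :: "'a::second_countable_topology set"
  shows "countable {x \<in> S. \<not> x islimpt S}"
proof -
  obtain B :: "'a set set" where B: "countable B" "topological_basis B"
    using ex_countable_basis by blast
  have "\<exists>U\<in>B. U \<inter> S = {x}" if x: "x \<in> S" "\<not> x islimpt S" for x
  proof -
    obtain T where T: "open T" "x \<in> T" "\<forall>y\<in>S. y \<in> T \<longrightarrow> y = x"
      using x(2) unfolding islimpt_def by blast
    obtain U where U: "U \<in> B" "x \<in> U" "U \<subseteq> T"
      using topological_basisE[OF B(2) T(1,2)] .
    have "U \<inter> S = {x}"
      using T(3) U(2,3) x(1) by blast
    then show ?thesis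
      using U(1) by blast
  qed
  then have "\<forall>x\<in>{x \<in> S. \<not> x islimpt S}. \<exists>U. U \<in> B \<and> U \<inter> S = {x}"
    by blast
  then obtain U where U: "\<forall>x\<in>{x \<in> S. \<not> x islimpt S}. U x \<in> B \<and> U x \<inter> S = {x}"
    unfolding bchoice_iff by blast
  have "inj_on U {x \<in> S. \<not> x islimpt S}"
  proof (rule inj_onI)
    fix x y assume "x \<in> {x \<in> S. \<not> x islimpt S}" "y \<in> {x \<in> S. \<not> x islimpt S}" "U x = U y"
    then have "{x} = {y}"
      using U by metis
    then show "x = y"
      by simp
  qed
  moreover have "U ` {x \<in> S. \<not> x islimpt S} \<subseteq> B"
    using U by blast
  ultimately show ?thesis
    by (meson B(1) countable_image_inj_on countable_subset)
qed

lemma has_vector_derivative_epsilon: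
  assumes "(y has_vector_derivative v) (at t within S)" "e > 0"
  obtains d where "d > 0"
    "\<And>s. s \<in> S \<Longrightarrow> \<bar>s - t\<bar> < d \<Longrightarrow> norm (y s - y t - (s - t) *\<^sub>R v) \<le> e * \<bar>s - t\<bar>"
  using assms unfolding has_vector_derivative_def has_derivative_within_alt by force

lemma vector_derivative_zero_at_limit_of_zeros:
  fixes y :: "real \<Rightarrow> 'a::real_normed_vector"
  assumes y: "(y has_vector_derivative v) (at t)" and "y t = 0" "t islimpt {s. y s = 0}"
  shows "v = 0"
proof -
  have "norm v \<le> e" if "e > 0" for e
  proof -
    obtain d where d: "d > 0" "\<And>s. \<bar>s - t\<bar> < d \<Longrightarrow> norm (y s - y t - (s - t) *\<^sub>R v) \<le> e * \<bar>s - t\<bar>"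
      using has_vector_derivative_epsilon[OF y \<open>e > 0\<close>] by (metis UNIV_I)
    obtain s where "y s = 0" "s \<noteq> t" "\<bar>s - t\<bar> < d"
      using assms(3) d(1) unfolding islimpt_approachable by (auto simp: dist_real_def)
    then show ?thesis
      using d(2)[of s] \<open>y t = 0\<close> by (simp add: mult.commute)
  qed
  from this[of "norm v / 2"] show ?thesis
    by (cases "v = 0") auto
qed

text \<open>
  The norm fails to be differentiable only at the origin. A curve can pass through the origin with
  nonzero velocity only at isolated zeros, and these are countable, hence negligible. At a limit of
  zeros a velocity must vanish, so the norm of the curve has derivative zero there, and the chain rule
  holds with any element of the unit ball in place of the gradient of the norm.
\<close>

lemma norm_has_derivative_off_isolated_zeros:
  fixes y :: "real \<Rightarrow> 'a::real_inner"
  assumes y: "(y has_vector_derivative v) (at t)" and t: "y t = 0 \<Longrightarrow> t islimpt {s. y s = 0}"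
    and u: "u \<in> T_regu (y t)"
  shows "((\<lambda>s. norm (y s)) has_real_derivative u \<bullet> v) (at t)"
proof (cases "y t = 0")
  case True
  then have "v = 0"
    using vector_derivative_zero_at_limit_of_zeros[OF y] t by blast
  have "((\<lambda>s. norm (y s)) has_derivative (\<lambda>_. 0)) (at t)"
    using y True unfolding \<open>v = 0\<close> has_vector_derivative_def has_derivative_within_alt
    by simp
  then show ?thesis
    unfolding has_field_derivative_def by (rule has_derivative_eq_rhs) (auto simp: \<open>v = 0\<close>)
next
  case False
  then have "((\<lambda>s. norm (y s)) has_derivative (\<lambda>h. sgn (y t) \<bullet> (h *\<^sub>R v))) (at t)"
    using has_derivative_compose[OF y[unfolded has_vector_derivative_def] has_derivative_norm] by (simp add: inner_commute)
  then show ?thesis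
    using u False by (simp add: has_field_derivative_def T_regu_def sgn_div_norm mult_commute_abs)
qed

section \<open>Selection of indices and Lipschitz extension\<close>

lemma strict_mono_selection:
  fixes P :: "nat \<Rightarrow> nat \<Rightarrow> bool"
  assumes "\<And>n K. \<exists>k\<ge>K. P n k"
  shows "\<exists>r. strict_mono r \<and> (\<forall>n. P n (r n))"
proof -
  have "\<exists>r. \<forall>n. P n (r n) \<and> r n < r (Suc n)"
  proof (rule dependent_nat_choice)
    show "\<exists>k. P 0 k"
      using assms by blast
    fix k n
    show "\<exists>k'. P (Suc n) k' \<and> k < k'"
      using assms[of "Suc k" "Suc n"] by (meson Suc_le_lessD)
  qed
  then show ?thesis
    unfolding strict_mono_Suc_iff by blast
qed

text \<open>
  McShane's extension by an infimum of cones. It will provide Lipschitz curves through the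
  iterates.
\<close>

lemma lipschitz_extension_real:
  fixes f :: "'a::metric_space \<Rightarrow> real"
  assumes f: "L-lipschitz_on S f" and "S \<noteq> {}"
  obtains g where "L-lipschitz_on UNIV g" "\<And>x. x \<in> S \<Longrightarrow> g x = f x"
proof
  define g where "g x = (INF y\<in>S. f y + L * dist x y)" for x
  have "L \<ge> 0"
    using f by (rule lipschitz_on_nonneg)
  have lower: "f z - L * dist x z \<le> f y + L * dist x y" if "y \<in> S" "z \<in> S" for x y z
  proof -
    have "f z - f y \<le> L * dist z y"
      using lipschitz_onD[OF f that(2,1)] by (auto simp: dist_real_def)
    moreover have "L * dist z y \<le> L * (dist x z + dist x y)"
      using \<open>L \<ge> 0\<close> by (intro mult_left_mono) (auto intro: dist_triangle3)
    ultimately show ?thesis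
      by (simp add: algebra_simps)
  qed
  have bdd: "bdd_below ((\<lambda>y. f y + L * dist x y) ` S)" for x
    using \<open>S \<noteq> {}\<close> lower by (meson bdd_belowI2 equals0I)
  have "g x \<le> g z + L * dist x z" for x z
  proof -
    have "g x - L * dist x z \<le> f y + L * dist z y" if "y \<in> S" for y
    proof -
      have "g x \<le> f y + L * dist x y"
        unfolding g_def by (rule cINF_lower[OF bdd that])
      also have "L * dist x y \<le> L * (dist x z + dist z y)"
        using \<open>L \<ge> 0\<close> by (intro mult_left_mono dist_triangle)
      finally show ?thesis
        by (simp add: algebra_simps)
    qed
    then have "g x - L * dist x z \<le> g z"
      unfolding g_def[of z] using \<open>S \<noteq> {}\<close> by (intro cINF_greatest)
    then show ?thesis
      by simp
  qed
  then have "\<bar>g x - g z\<bar> \<le> L * dist x z" for x z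
    by (smt (verit) dist_commute)
  then show "L-lipschitz_on UNIV g"
    using \<open>L \<ge> 0\<close> by (intro lipschitz_onI) (auto simp: dist_real_def)
  show "g x = f x" if "x \<in> S" for x
  proof (rule antisym)
    show "g x \<le> f x"
      unfolding g_def using cINF_lower[OF bdd that, of x] by simp
    show "f x \<le> g x"
      unfolding g_def using \<open>S \<noteq> {}\<close> lower[OF _ that, of _ x] by (intro cINF_greatest) auto
  qed
qed

lemma lipschitz_extension:
  fixes f :: "'a::metric_space \<Rightarrow> 'b::euclidean_space"
  assumes f: "L-lipschitz_on S f" and "S \<noteq> {}"
  obtains g C where "C-lipschitz_on UNIV g" "\<And>x. x \<in> S \<Longrightarrow> g x = f x"
proof -
  have "\<exists>h. L-lipschitz_on UNIV h \<and> (\<forall>x\<in>S. h x = f x \<bullet> b)" if "b \<in> Basis" for b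
  proof -
    have "L-lipschitz_on S (\<lambda>x. f x \<bullet> b)"
    proof (rule lipschitz_onI)
      fix x y assume "x \<in> S" "y \<in> S"
      then show "dist (f x \<bullet> b) (f y \<bullet> b) \<le> L * dist x y"
        using Basis_le_norm[OF that, of "f x - f y"] lipschitz_onD[OF f, of x y]
        by (simp add: dist_real_def dist_norm inner_diff_left)
    qed (rule lipschitz_on_nonneg[OF f])
    then show ?thesis
      by (rule lipschitz_extension_real[OF _ \<open>S \<noteq> {}\<close>]) blast
  qed
  then have "\<forall>b\<in>Basis. \<exists>h. L-lipschitz_on UNIV h \<and> (\<forall>x\<in>S. h x = f x \<bullet> b)"
    by blast
  then obtain h where h: "\<forall>b\<in>Basis. L-lipschitz_on UNIV (h b) \<and> (\<forall>x\<in>S. h b x = f x \<bullet> b)"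
    unfolding bchoice_iff by blast
  define g where "g x = (\<Sum>b\<in>Basis. h b x *\<^sub>R b)" for x
  have "(real DIM('b) * L)-lipschitz_on UNIV g"
  proof (rule lipschitz_onI)
    fix x y
    have "dist (g x) (g y) \<le> (\<Sum>b\<in>(Basis :: 'b set). \<bar>(g x - g y) \<bullet> b\<bar>)"
      unfolding dist_norm by (rule norm_le_l1)
    also have "\<dots> \<le> (\<Sum>b\<in>(Basis :: 'b set). L * dist x y)"
    proof (rule sum_mono)
      fix b :: 'b assume b: "b \<in> Basis"
      then have "(g x - g y) \<bullet> b = h b x - h b y"
        by (simp add: g_def inner_diff_left)
      then show "\<bar>(g x - g y) \<bullet> b\<bar> \<le> L * dist x y"
        using h b by (auto simp: lipschitz_on_def dist_real_def)
    qed
    finally show "dist (g x) (g y) \<le> real DIM('b) * L * dist x y"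
      by simp
  qed (use lipschitz_on_nonneg[OF f] in auto)
  moreover have "g x = f x" if "x \<in> S" for x
    unfolding g_def using h that by (simp add: euclidean_representation)
  ultimately show thesis
    using that by blast
qed

section \<open>The clock of the step sizes\<close>

lemma step_time_Suc: "step_time \<eta> (Suc k) = step_time \<eta> k + \<eta> k"
  by (simp add: step_time_def)

lemma step_index_upper:
  assumes "filterlim (step_time \<eta>) at_top sequentially" "step_time \<eta> k \<le> t"
  shows "k \<le> step_index \<eta> t"
proof -
  obtain K where "\<And>n. n \<ge> K \<Longrightarrow> t + 1 \<le> step_time \<eta> n"
    using assms(1) unfolding filterlim_at_top eventually_sequentially by blast
  then have "n < K" if "step_time \<eta> n \<le> t" for n
    using that by (meson add_le_same_cancel1 leI not_one_le_zero order.trans)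
  then have "bdd_above {n. step_time \<eta> n \<le> t}"
    by (intro bdd_aboveI[of _ K]) (auto intro: less_imp_le)
  then show ?thesis
    unfolding step_index_def using assms(2) by (intro cSup_upper) auto
qed

lemma step_index_bracket:
  assumes time: "filterlim (step_time \<eta>) at_top sequentially" and "t \<ge> 0"
  shows "step_time \<eta> (step_index \<eta> t) \<le> t" "t < step_time \<eta> (Suc (step_index \<eta> t))"
proof -
  let ?A = "{n. step_time \<eta> n \<le> t}"
  have "0 \<in> ?A"
    using \<open>t \<ge> 0\<close> by (simp add: step_time_def)
  moreover have "finite ?A"
    using step_index_upper[OF time] by (intro finite_subset[of ?A "{..step_index \<eta> t}"]) auto
  ultimately have "Sup ?A \<in> ?A"
    using Max_in[of ?A] unfolding Sup_nat_def by (metis empty_iff)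
  then show "step_time \<eta> (step_index \<eta> t) \<le> t"
    by (simp add: step_index_def)
  show "t < step_time \<eta> (Suc (step_index \<eta> t))"
    using step_index_upper[OF time, of "Suc (step_index \<eta> t)" t] by force
qed

section \<open>Limit curves of perturbed iterations\<close>

text \<open>
  The iterates are an Euler scheme for the differential inclusion \<open>x' \<in> - Q x\<close> with perturbations
  \<open>e\<close> whose weighted sums vanish over time windows of unit length. The directions \<open>u k\<close> need not
  lie in \<open>Q (x k)\<close>; they only have to approach it, in the sense that limits of directions along
  convergent subsequences of iterates are values of \<open>Q\<close> at the limit.
\<close>

locale perturbed_inclusion =
  fixes x u e :: "nat \<Rightarrow> 'a::euclidean_space" and \<eta> :: "nat \<Rightarrow> real" and Q :: "'a \<Rightarrow> 'a set"
  assumes step: "x (Suc k) = x k - \<eta> k *\<^sub>R (u k + e k)"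
    and \<eta>_pos: "\<eta> k > 0" and \<eta>_lim: "\<eta> \<longlonglongrightarrow> 0"
    and time: "filterlim (step_time \<eta>) at_top sequentially"
    and x_bounded: "bounded (range x)" and u_bounded: "bounded (range u)" and e_bounded: "bounded (range e)"
    and noise: "\<epsilon> > 0 \<Longrightarrow> \<exists>I. \<forall>i\<ge>I. \<forall>m\<ge>i. step_time \<eta> m \<le> step_time \<eta> i + 1 \<longrightarrow>
                  norm (\<Sum>k=i..<m. \<eta> k *\<^sub>R e k) \<le> \<epsilon>"
    and Q_closed: "closed (Q z)" and Q_convex: "convex (Q z)"
    and Q_limit: "strict_mono r \<Longrightarrow> (x \<circ> r) \<longlonglongrightarrow> a \<Longrightarrow> (u \<circ> r) \<longlonglongrightarrow> q \<Longrightarrow> q \<in> Q a"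
begin

abbreviation \<sigma> :: "nat \<Rightarrow> real" where "\<sigma> \<equiv> step_time \<eta>"

lemma time_strict_mono: "strict_mono \<sigma>"
  by (simp add: strict_mono_Suc_iff step_time_Suc \<eta>_pos)

lemma time_nonneg: "0 \<le> \<sigma> k"
  unfolding step_time_def by (intro sum_nonneg less_imp_le \<eta>_pos)

lemma time_le_iff: "\<sigma> i \<le> \<sigma> j \<longleftrightarrow> i \<le> j"
  using time_strict_mono by (rule strict_mono_less_eq)

lemma speed_bound:
  obtains L where "\<And>i j. dist (x i) (x j) \<le> L * \<bar>\<sigma> i - \<sigma> j\<bar>" "L \<ge> 0"
proof -
  obtain B C where B: "\<And>k. norm (u k) \<le> B" and C: "\<And>k. norm (e k) \<le> C"
    using u_bounded e_bounded unfolding bounded_iff by blast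
  have step_le: "dist (x (Suc k)) (x k) \<le> (B + C) * \<eta> k" for k
  proof -
    have "norm (u k + e k) \<le> B + C"
      using B[of k] C[of k] norm_triangle_ineq[of "u k" "e k"] by linarith
    then show ?thesis
      using \<eta>_pos[of k] by (simp add: dist_norm step mult.commute)
  qed
  have le: "dist (x j) (x i) \<le> (B + C) * (\<sigma> j - \<sigma> i)" if "i \<le> j" for i j
    using that
  proof (induction j rule: dec_induct)
    case (step n)
    have "dist (x (Suc n)) (x i) \<le> dist (x (Suc n)) (x n) + dist (x n) (x i)"
      by (rule dist_triangle)
    then show ?case
      using step.IH step_le[of n] by (simp add: step_time_Suc algebra_simps)
  qed simp
  show thesis
  proof
    fix i j
    show "dist (x i) (x j) \<le> (B + C) * \<bar>\<sigma> i - \<sigma> j\<bar>"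
      using le[of i j] le[of j i] time_le_iff[of i j] time_le_iff[of j i]
      by (cases "i \<le> j") (auto simp: dist_commute)
    show "B + C \<ge> 0"
      using B[of 0] C[of 0] norm_ge_zero[of "u 0"] norm_ge_zero[of "e 0"] by linarith
  qed
qed

lemma consecutive_difference: "(\<lambda>k. x (Suc k) - x k) \<longlonglongrightarrow> 0"
proof -
  obtain L where L: "\<And>i j. dist (x i) (x j) \<le> L * \<bar>\<sigma> i - \<sigma> j\<bar>"
    by (rule speed_bound) blast
  have "norm (x (Suc k) - x k) \<le> L * \<eta> k" for k
    using L[of "Suc k" k] \<eta>_pos[of k] by (simp add: dist_norm step_time_Suc)
  then have "\<forall>\<^sub>F k in sequentially. norm (x (Suc k) - x k) \<le> L * \<eta> k"
    by simp
  then show ?thesis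
    by (rule Lim_null_comparison) (rule tendsto_mult_right_zero[OF \<eta>_lim])
qed

lemma lipschitz_interpolation:
  obtains y C where "C-lipschitz_on UNIV y" "\<And>k. y (\<sigma> k) = x k"
proof -
  obtain L where L: "\<And>i j. dist (x i) (x j) \<le> L * \<bar>\<sigma> i - \<sigma> j\<bar>" "L \<ge> 0"
    by (rule speed_bound) (rule that)
  define f where "f = x \<circ> inv \<sigma>"
  have f: "f (\<sigma> k) = x k" for k
    unfolding f_def using strict_mono_imp_inj_on[OF time_strict_mono] by simp
  \<comment> \<open>The iterates, regarded as a function of the elapsed time, move at bounded speed.\<close>
  have "L-lipschitz_on (range \<sigma>) f"
    by (rule lipschitz_onI) (use L in \<open>auto simp: f dist_real_def\<close>)
  then obtain y C where "C-lipschitz_on UNIV y" "\<And>t. t \<in> range \<sigma> \<Longrightarrow> y t = f t"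
    using lipschitz_extension by blast
  then show thesis
    using that f by auto
qed

text \<open>
  Along the start indices \<open>i n\<close>, the iterates during the next unit of time follow the curve \<open>\<gamma>\<close>
  uniformly, with an error that vanishes as \<open>n\<close> grows.
\<close>

definition shadows :: "(nat \<Rightarrow> nat) \<Rightarrow> (real \<Rightarrow> 'a) \<Rightarrow> bool" where
  "shadows i \<gamma> \<longleftrightarrow> (\<forall>\<epsilon>>0. \<forall>\<^sub>F n in sequentially.
     \<forall>k\<ge>i n. \<sigma> k \<le> \<sigma> (i n) + 1 \<longrightarrow> dist (x k) (\<gamma> (\<sigma> k - \<sigma> (i n))) < \<epsilon>)"

text \<open>
  Arzela--Ascoli, applied to the time-shifted interpolations. Outside the unit interval the curve is
  continued as a constant, because the chain rule below refers to curves on the whole line.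
\<close>

lemma limit_curve:
  assumes r: "strict_mono r" and a: "(x \<circ> r) \<longlonglongrightarrow> a"
  obtains s \<gamma> L where "strict_mono s" "L-lipschitz_on UNIV \<gamma>" "\<gamma> 0 = a" "shadows (r \<circ> s) \<gamma>"
    "\<And>t. \<gamma> t = \<gamma> (max 0 (min 1 t))"
proof -
  obtain y C where y: "C-lipschitz_on UNIV y" "\<And>k. y (\<sigma> k) = x k"
    by (rule lipschitz_interpolation) (rule that)
  have "C \<ge> 0"
    using y(1) by (rule lipschitz_on_nonneg)
  have y_dist: "norm (y s - y t) \<le> C * \<bar>s - t\<bar>" for s t
    using y(1) by (simp add: lipschitz_on_def dist_norm)
  define F where "F n t = y (\<sigma> (r n) + t)" for n t
  have F_dist: "norm (F n s - F n t) \<le> C * \<bar>s - t\<bar>" for n s t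
    unfolding F_def using y_dist[of "\<sigma> (r n) + s" "\<sigma> (r n) + t"] by simp
  obtain B where B: "\<And>k. norm (x k) \<le> B"
    using x_bounded unfolding bounded_iff by blast
  obtain \<gamma>0 s where \<gamma>0: "strict_mono (s :: nat \<Rightarrow> nat)"
    "\<And>\<epsilon>. 0 < \<epsilon> \<Longrightarrow> \<exists>N. \<forall>n t. n \<ge> N \<and> t \<in> {0..1} \<longrightarrow> norm (F (s n) t - \<gamma>0 t) < \<epsilon>"
  proof (rule Arzela_Ascoli[of "{0..1::real}" F "B + C"])
    fix n and t :: real assume "t \<in> {0..1}"
    then have "norm (F n t - F n 0) \<le> C"
      using F_dist[of n t 0] mult_left_mono[OF _ \<open>C \<ge> 0\<close>, of t 1] by auto
    moreover have "norm (F n 0) \<le> B"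
      by (simp add: F_def y(2) B)
    ultimately show "norm (F n t) \<le> B + C"
      by (smt (verit) norm_triangle_sub)
  next
    fix t \<epsilon> :: real assume "0 < \<epsilon>"
    show "\<exists>d>0. \<forall>n s. s \<in> {0..1} \<and> norm (t - s) < d \<longrightarrow> norm (F n t - F n s) < \<epsilon>"
    proof (intro exI[of _ "\<epsilon> / (C + 1)"] conjI allI impI)
      fix n s assume "s \<in> {0..1} \<and> norm (t - s) < \<epsilon> / (C + 1)"
      then have "(C + 1) * \<bar>t - s\<bar> < \<epsilon>"
        using \<open>C \<ge> 0\<close> by (simp add: field_simps)
      then show "norm (F n t - F n s) < \<epsilon>"
        using F_dist[of n t s] by (simp add: algebra_simps)
    qed (use \<open>C \<ge> 0\<close> \<open>0 < \<epsilon>\<close> in auto)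
  qed (use that in auto)
  define \<gamma> where "\<gamma> t = \<gamma>0 (max 0 (min 1 t))" for t
  have lim: "(\<lambda>n. F (s n) t) \<longlonglongrightarrow> \<gamma> t" if "t \<in> {0..1}" for t
  proof (rule LIMSEQ_I)
    fix \<epsilon> :: real assume "0 < \<epsilon>"
    then show "\<exists>N. \<forall>n\<ge>N. norm (F (s n) t - \<gamma> t) < \<epsilon>"
      using \<gamma>0(2)[of \<epsilon>] that by (auto simp: \<gamma>_def)
  qed
  have clamp: "\<gamma> t = \<gamma> (max 0 (min 1 t))" for t
    by (simp add: \<gamma>_def)
  have "C-lipschitz_on UNIV \<gamma>"
  proof (rule lipschitz_onI)
    fix t t' :: real
    let ?t = "max 0 (min 1 t)" and ?t' = "max 0 (min 1 t')"
    have "(\<lambda>n. norm (F (s n) ?t - F (s n) ?t')) \<longlonglongrightarrow> norm (\<gamma> ?t - \<gamma> ?t')"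
      by (intro tendsto_norm tendsto_diff lim) auto
    then have "norm (\<gamma> ?t - \<gamma> ?t') \<le> C * \<bar>?t - ?t'\<bar>"
      by (rule LIMSEQ_le_const2) (use F_dist in auto)
    also have "\<dots> \<le> C * \<bar>t - t'\<bar>"
      using \<open>C \<ge> 0\<close> by (intro mult_left_mono) auto
    finally show "dist (\<gamma> t) (\<gamma> t') \<le> C * dist t t'"
      using clamp[of t] clamp[of t'] by (simp add: dist_norm)
  qed fact
  moreover have "\<gamma> 0 = a"
  proof (rule LIMSEQ_unique)
    show "(\<lambda>n. F (s n) 0) \<longlonglongrightarrow> \<gamma> 0"
      by (rule lim) auto
    show "(\<lambda>n. F (s n) 0) \<longlonglongrightarrow> a"
      using LIMSEQ_subseq_LIMSEQ[OF a \<gamma>0(1)] by (simp add: F_def y(2) o_def)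
  qed
  moreover have "shadows (r \<circ> s) \<gamma>"
    unfolding shadows_def
  proof (intro allI impI)
    fix \<epsilon> :: real assume "\<epsilon> > 0"
    then obtain N where N: "\<And>n t. n \<ge> N \<Longrightarrow> t \<in> {0..1} \<Longrightarrow> norm (F (s n) t - \<gamma>0 t) < \<epsilon>"
      using \<gamma>0(2) by blast
    have "dist (x k) (\<gamma> (\<sigma> k - \<sigma> ((r \<circ> s) n))) < \<epsilon>"
      if "n \<ge> N" "k \<ge> (r \<circ> s) n" "\<sigma> k \<le> \<sigma> ((r \<circ> s) n) + 1" for n k
      using N[OF that(1), of "\<sigma> k - \<sigma> (r (s n))"] that(2,3) time_le_iff[of "r (s n)" k]
      by (simp add: F_def y(2) \<gamma>_def dist_norm)
    then show "\<forall>\<^sub>F n in sequentially. \<forall>k\<ge>(r \<circ> s) n.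
        \<sigma> k \<le> \<sigma> ((r \<circ> s) n) + 1 \<longrightarrow> dist (x k) (\<gamma> (\<sigma> k - \<sigma> ((r \<circ> s) n))) < \<epsilon>"
      unfolding eventually_sequentially by blast
  qed
  ultimately show thesis
    using that \<gamma>0(1) clamp by blast
qed

text \<open>
  The last iterate within time \<open>t\<close> after iterate \<open>i\<close>. It is early by less than one step size, so
  the values of a shadowed curve are limits of such iterates.
\<close>

abbreviation index_after :: "nat \<Rightarrow> real \<Rightarrow> nat" where
  "index_after i t \<equiv> step_index \<eta> (\<sigma> i + t)"

lemma index_after:
  assumes "t \<ge> 0"
  shows "i \<le> index_after i t" "\<sigma> (index_after i t) \<le> \<sigma> i + t"
    "\<sigma> i + t \<le> \<sigma> (index_after i t) + \<eta> (index_after i t)"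
proof -
  have "\<sigma> i + t \<ge> 0"
    using time_nonneg[of i] assms by simp
  note bracket = step_index_bracket[OF time this]
  show "i \<le> index_after i t"
    using assms by (intro step_index_upper[OF time]) simp
  show "\<sigma> (index_after i t) \<le> \<sigma> i + t" "\<sigma> i + t \<le> \<sigma> (index_after i t) + \<eta> (index_after i t)"
    using bracket by (simp_all add: step_time_Suc)
qed

lemma index_after_lims:
  assumes i: "filterlim i at_top sequentially" and "t \<ge> 0"
  shows "filterlim (\<lambda>n. index_after (i n) t) at_top sequentially"
    and "(\<lambda>n. \<sigma> (index_after (i n) t) - \<sigma> (i n)) \<longlonglongrightarrow> t"
proof -
  show k: "filterlim (\<lambda>n. index_after (i n) t) at_top sequentially"
    by (rule filterlim_at_top_mono[OF i]) (simp add: index_after(1)[OF \<open>t \<ge> 0\<close>])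
  have "(\<lambda>n. \<eta> (index_after (i n) t)) \<longlonglongrightarrow> 0"
    by (rule filterlim_compose[OF \<eta>_lim k])
  then have lower: "(\<lambda>n. t - \<eta> (index_after (i n) t)) \<longlonglongrightarrow> t"
    using tendsto_diff[OF tendsto_const] by fastforce
  show "(\<lambda>n. \<sigma> (index_after (i n) t) - \<sigma> (i n)) \<longlonglongrightarrow> t"
  proof (rule tendsto_sandwich[OF _ _ lower tendsto_const])
    show "\<forall>\<^sub>F n in sequentially. t - \<eta> (index_after (i n) t) \<le> \<sigma> (index_after (i n) t) - \<sigma> (i n)"
      using index_after(3)[OF \<open>t \<ge> 0\<close>] by (simp add: algebra_simps)
    show "\<forall>\<^sub>F n in sequentially. \<sigma> (index_after (i n) t) - \<sigma> (i n) \<le> t"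
      using index_after(2)[OF \<open>t \<ge> 0\<close>] by (simp add: algebra_simps)
  qed
qed

lemma shadows_limit:
  assumes sh: "shadows i \<gamma>" and i: "filterlim i at_top sequentially"
    and \<gamma>: "L-lipschitz_on UNIV \<gamma>" and t: "0 \<le> t" "t \<le> 1"
  shows "(\<lambda>n. x (index_after (i n) t)) \<longlonglongrightarrow> \<gamma> t"
proof -
  let ?k = "\<lambda>n. index_after (i n) t"
  have "(\<lambda>n. x (?k n) - \<gamma> (\<sigma> (?k n) - \<sigma> (i n))) \<longlonglongrightarrow> 0"
  proof (rule tendstoI)
    fix \<epsilon> :: real assume "\<epsilon> > 0"
    have "\<sigma> (?k n) \<le> \<sigma> (i n) + 1" for n
      using index_after(2)[OF t(1), of "i n"] t(2) by simp
    moreover have "\<forall>\<^sub>F n in sequentially. \<forall>k\<ge>i n. \<sigma> k \<le> \<sigma> (i n) + 1 \<longrightarrow>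
        dist (x k) (\<gamma> (\<sigma> k - \<sigma> (i n))) < \<epsilon>"
      using sh \<open>\<epsilon> > 0\<close> unfolding shadows_def by blast
    ultimately show "\<forall>\<^sub>F n in sequentially. dist (x (?k n) - \<gamma> (\<sigma> (?k n) - \<sigma> (i n))) 0 < \<epsilon>"
      by (auto elim!: eventually_mono simp: index_after(1)[OF t(1)] dist_norm)
  qed
  moreover have "(\<lambda>n. \<gamma> (\<sigma> (?k n) - \<sigma> (i n))) \<longlonglongrightarrow> \<gamma> t"
    using lipschitz_on_continuous_on[OF \<gamma>] index_after_lims(2)[OF i t(1)]
    by (auto intro: continuous_on_tendsto_compose)
  ultimately show ?thesis
    using tendsto_add by fastforce
qed

text \<open>
  The limit property of \<open>Q\<close>, restated for the half-spaces that contain \<open>Q a\<close>: a sequence of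
  directions violating it near \<open>a\<close> would have a limit in \<open>Q a\<close> on the wrong side.
\<close>

lemma eventually_in_half_space:
  assumes "\<And>q. q \<in> Q a \<Longrightarrow> \<alpha> < p \<bullet> q"
  shows "\<exists>r>0. \<exists>K. \<forall>k\<ge>K. dist (x k) a < r \<longrightarrow> \<alpha> < p \<bullet> u k"
proof (rule ccontr)
  assume "\<not> ?thesis"
  then have bad: "\<exists>k\<ge>K. dist (x k) a < r \<and> p \<bullet> u k \<le> \<alpha>" if "r > 0" for r K
    using that by (meson not_less)
  obtain r where r: "strict_mono r"
    "\<And>n. dist (x (r n)) a < inverse (real (Suc n)) \<and> p \<bullet> u (r n) \<le> \<alpha>"
    using strict_mono_selection[of "\<lambda>n k. dist (x k) a < inverse (real (Suc n)) \<and> p \<bullet> u k \<le> \<alpha>"]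
      bad[of "inverse (real (Suc _))"] by auto
  have "(\<lambda>n. x (r n)) \<longlonglongrightarrow> a"
    using r(2) LIMSEQ_inverse_real_of_nat
    by (intro metric_tendsto_imp_tendsto[OF LIMSEQ_inverse_real_of_nat])
      (auto simp: dist_real_def less_imp_le intro!: always_eventually)
  moreover have "bounded (range (u \<circ> r))"
    using u_bounded by (rule bounded_subset) auto
  then obtain q s where s: "strict_mono s" "(u \<circ> r \<circ> s) \<longlonglongrightarrow> q"
    using bounded_imp_convergent_subsequence by blast
  ultimately have "(x \<circ> (r \<circ> s)) \<longlonglongrightarrow> a" "(u \<circ> (r \<circ> s)) \<longlonglongrightarrow> q"
    using LIMSEQ_subseq_LIMSEQ[of "\<lambda>n. x (r n)" a s] by (simp_all add: o_def)
  then have "q \<in> Q a"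
    using Q_limit[OF strict_mono_o[OF r(1) s(1)]] by blast
  moreover have "p \<bullet> q \<le> \<alpha>"
    using tendsto_inner[OF tendsto_const s(2), of p] r(2)
    by (intro LIMSEQ_le_const2[of "\<lambda>n. p \<bullet> (u \<circ> r \<circ> s) n"]) auto
  ultimately show False
    using assms by fastforce
qed

text \<open>
  If \<open>- v\<close> were outside the closed convex set \<open>Q (\<gamma> t)\<close>, a hyperplane would separate them. All
  directions used shortly after time \<open>t\<close> lie on the side of \<open>Q (\<gamma> t)\<close>; summing the steps, the
  displacement of the iterates, and in the limit that of \<open>\<gamma>\<close>, stays on that side too, so \<open>v\<close> cannot
  be the velocity. Averages of directions are controlled by one linear functional at a time, which
  avoids weak convergence of derivatives.
\<close>

lemma limit_inclusion:
  assumes sh: "shadows i \<gamma>" and i: "filterlim i at_top sequentially"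
    and \<gamma>: "L-lipschitz_on UNIV \<gamma>" and t: "0 \<le> t" "t < 1"
    and v: "(\<gamma> has_vector_derivative v) (at t)"
  shows "- v \<in> Q (\<gamma> t)"
proof (rule ccontr)
  assume "- v \<notin> Q (\<gamma> t)"
  then obtain p \<alpha> where p: "p \<bullet> (- v) < \<alpha>" "\<And>q. q \<in> Q (\<gamma> t) \<Longrightarrow> \<alpha> < p \<bullet> q"
    using separating_hyperplane_closed_point[OF Q_convex Q_closed] by metis
  then obtain r K where r: "r > 0" and K: "\<And>k. k \<ge> K \<Longrightarrow> dist (x k) (\<gamma> t) < r \<Longrightarrow> \<alpha> < p \<bullet> u k"
    using eventually_in_half_space[of "\<gamma> t" \<alpha> p] by metis
  have "L \<ge> 0"
    using \<gamma> by (rule lipschitz_on_nonneg)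
  have advance: "p \<bullet> (\<gamma> (t + h) - \<gamma> t) \<le> - \<alpha> * h"
    if h: "0 < h" "t + h \<le> 1" "L * h < r / 2" for h
  proof -
    let ?k = "\<lambda>n. index_after (i n) t" and ?m = "\<lambda>n. index_after (i n) (t + h)"
    have km: "i n \<le> ?k n" "?k n \<le> ?m n" for n
      using index_after[of t "i n"] index_after[of "t + h" "i n"] t h
        step_index_upper[OF time, of "?k n" "\<sigma> (i n) + (t + h)"] by auto
    have lims: "(\<lambda>n. \<sigma> (?k n) - \<sigma> (i n)) \<longlonglongrightarrow> t" "(\<lambda>n. \<sigma> (?m n) - \<sigma> (i n)) \<longlonglongrightarrow> t + h"
      "(\<lambda>n. x (?k n)) \<longlonglongrightarrow> \<gamma> t" "(\<lambda>n. x (?m n)) \<longlonglongrightarrow> \<gamma> (t + h)"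
      using index_after_lims(2)[OF i] shadows_limit[OF sh i \<gamma>] t h by auto
    have "(\<lambda>n. p \<bullet> (x (?m n) - x (?k n)) + \<alpha> * ((\<sigma> (?m n) - \<sigma> (i n)) - (\<sigma> (?k n) - \<sigma> (i n))))
        \<longlonglongrightarrow> p \<bullet> (\<gamma> (t + h) - \<gamma> t) + \<alpha> * ((t + h) - t)"
      by (intro tendsto_intros lims)
    then have lim: "(\<lambda>n. p \<bullet> (x (?m n) - x (?k n)) + \<alpha> * (\<sigma> (?m n) - \<sigma> (?k n)))
        \<longlonglongrightarrow> p \<bullet> (\<gamma> (t + h) - \<gamma> t) + \<alpha> * h"
      by simp
    have "p \<bullet> (\<gamma> (t + h) - \<gamma> t) + \<alpha> * h \<le> \<epsilon>" if "\<epsilon> > 0" for \<epsilon>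
    proof -
      define \<epsilon>' where "\<epsilon>' = \<epsilon> / (norm p + 1)"
      have "\<epsilon>' > 0" "norm p * \<epsilon>' \<le> \<epsilon>"
        using \<open>\<epsilon> > 0\<close> by (auto simp: \<epsilon>'_def field_simps add_pos_nonneg)
      obtain I where I: "\<And>j m. j \<ge> I \<Longrightarrow> m \<ge> j \<Longrightarrow> \<sigma> m \<le> \<sigma> j + 1 \<Longrightarrow>
          norm (\<Sum>k=j..<m. \<eta> k *\<^sub>R e k) \<le> \<epsilon>'"
        using noise[OF \<open>\<epsilon>' > 0\<close>] by blast
      have "\<forall>\<^sub>F n in sequentially. \<bar>(\<sigma> (?k n) - \<sigma> (i n)) - t\<bar> < h"
        using tendstoD[OF lims(1) h(1)] by (simp add: dist_real_def)
      moreover have "\<forall>\<^sub>F n in sequentially. i n \<ge> max K I"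
        using i unfolding filterlim_at_top by blast
      moreover have "\<forall>\<^sub>F n in sequentially. \<forall>k\<ge>i n. \<sigma> k \<le> \<sigma> (i n) + 1 \<longrightarrow>
          dist (x k) (\<gamma> (\<sigma> k - \<sigma> (i n))) < r / 2"
        using sh half_gt_zero[OF r] unfolding shadows_def by blast
      ultimately have "\<forall>\<^sub>F n in sequentially.
          p \<bullet> (x (?m n) - x (?k n)) + \<alpha> * (\<sigma> (?m n) - \<sigma> (?k n)) \<le> \<epsilon>"
      proof eventually_elim
        case (elim n)
        have near: "\<alpha> < p \<bullet> u k" if "?k n \<le> k" "k < ?m n" for k
        proof (rule K)
          have k: "\<sigma> (?k n) \<le> \<sigma> k" "\<sigma> k \<le> \<sigma> (?m n)"
            using that by (simp_all add: time_le_iff)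
          then have "\<sigma> k - \<sigma> (i n) \<le> t + h"
            using index_after(2)[of "t + h" "i n"] t h by simp
          then have "\<bar>(\<sigma> k - \<sigma> (i n)) - t\<bar> \<le> h"
            using elim(1) k(1) by linarith
          then have "L * \<bar>(\<sigma> k - \<sigma> (i n)) - t\<bar> \<le> L * h"
            using \<open>L \<ge> 0\<close> by (rule mult_left_mono)
          then have "dist (\<gamma> (\<sigma> k - \<sigma> (i n))) (\<gamma> t) < r / 2"
            using lipschitz_onD[OF \<gamma>, of "\<sigma> k - \<sigma> (i n)" t] h(3) by (simp add: dist_real_def)
          moreover have "dist (x k) (\<gamma> (\<sigma> k - \<sigma> (i n))) < r / 2"
            using elim(3) km[of n] that \<open>\<sigma> k - \<sigma> (i n) \<le> t + h\<close> h(2) by auto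
          ultimately show "dist (x k) (\<gamma> t) < r"
            using dist_triangle[of "x k" "\<gamma> t" "\<gamma> (\<sigma> k - \<sigma> (i n))"] by linarith
          show "k \<ge> K"
            using elim(2) km[of n] that by simp
        qed
        have "p \<bullet> (x m - x (?k n)) + \<alpha> * (\<sigma> m - \<sigma> (?k n)) \<le> - (p \<bullet> (\<Sum>k=?k n..<m. \<eta> k *\<^sub>R e k))"
          if "?k n \<le> m" "m \<le> ?m n" for m
          using that
        proof (induction m rule: dec_induct)
          case (step m)
          have "\<eta> m * \<alpha> \<le> \<eta> m * (p \<bullet> u m)"
            using near[of m] step \<eta>_pos[of m] by (intro mult_left_mono) auto
          then show ?case
            using step by (simp add: perturbed_inclusion.step[OF perturbed_inclusion_axioms]
                step_time_Suc algebra_simps inner_simps)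
        qed simp
        then have "p \<bullet> (x (?m n) - x (?k n)) + \<alpha> * (\<sigma> (?m n) - \<sigma> (?k n))
            \<le> - (p \<bullet> (\<Sum>k=?k n..<?m n. \<eta> k *\<^sub>R e k))"
          using km[of n] by blast
        also have "\<dots> \<le> norm p * norm (\<Sum>k=?k n..<?m n. \<eta> k *\<^sub>R e k)"
          using Cauchy_Schwarz_ineq2[of p "\<Sum>k=?k n..<?m n. \<eta> k *\<^sub>R e k"] by linarith
        also have "\<dots> \<le> norm p * \<epsilon>'"
        proof (intro mult_left_mono I)
          show "I \<le> ?k n" "?k n \<le> ?m n"
            using elim(2) km[of n] by auto
          show "\<sigma> (?m n) \<le> \<sigma> (?k n) + 1"
            using index_after(2)[of "t + h" "i n"] t h km(1)[of n] time_le_iff[of "i n" "?k n"] by simp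
        qed simp
        finally show ?case
          using \<open>norm p * \<epsilon>' \<le> \<epsilon>\<close> by linarith
      qed
      then show ?thesis
        using tendsto_upperbound[OF lim] by simp
    qed
    then have "p \<bullet> (\<gamma> (t + h) - \<gamma> t) + \<alpha> * h \<le> 0"
      by (rule dense_ge)
    then show ?thesis
      by simp
  qed
  \<comment> \<open>The first-order error \<open>norm p * \<kappa>\<close> is less than the gap \<open>p \<bullet> v + \<alpha>\<close> left by the separation.\<close>
  define B where "B = norm p + 1"
  define \<kappa> where "\<kappa> = (p \<bullet> v + \<alpha>) / (2 * B)"
  have "B > 0"
    by (simp add: B_def add_nonneg_pos)
  then have "\<kappa> > 0"
    using p(1) by (simp add: \<kappa>_def)
  then obtain d where d: "d > 0"
    "\<And>s. \<bar>s - t\<bar> < d \<Longrightarrow> norm (\<gamma> s - \<gamma> t - (s - t) *\<^sub>R v) \<le> \<kappa> * \<bar>s - t\<bar>"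
    using has_vector_derivative_epsilon[OF v \<open>\<kappa> > 0\<close>] by (metis UNIV_I)
  define h where "h = min (d / 2) (min (1 - t) (r / (4 * (L + 1))))"
  have h: "0 < h" "h < d" "t + h \<le> 1" "h \<le> r / (4 * (L + 1))"
    using d(1) t r \<open>L \<ge> 0\<close> by (auto simp: h_def)
  have "L * h \<le> L * (r / (4 * (L + 1)))"
    using h(4) \<open>L \<ge> 0\<close> by (rule mult_left_mono)
  also have "\<dots> < r / 2"
    using r \<open>L \<ge> 0\<close> by (simp add: field_simps add_pos_nonneg)
  finally have "p \<bullet> (\<gamma> (t + h) - \<gamma> t) \<le> - \<alpha> * h"
    using advance h by blast
  moreover have "\<bar>p \<bullet> (\<gamma> (t + h) - \<gamma> t - h *\<^sub>R v)\<bar> \<le> norm p * (\<kappa> * h)"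
    using Cauchy_Schwarz_ineq2[of p "\<gamma> (t + h) - \<gamma> t - h *\<^sub>R v"] d(2)[of "t + h"] h
    by (smt (verit) add_diff_cancel_left' mult_left_mono norm_ge_zero)
  ultimately have "h * (p \<bullet> v + \<alpha>) \<le> h * (norm p * \<kappa>)"
    by (simp add: inner_diff_right algebra_simps)
  then have "p \<bullet> v + \<alpha> \<le> norm p * \<kappa>"
    using h(1) by simp
  also have "\<dots> < B * \<kappa> * 2"
    using \<open>\<kappa> > 0\<close> by (simp add: B_def algebra_simps add_nonneg_pos)
  also have "\<dots> = p \<bullet> v + \<alpha>"
    using \<open>B > 0\<close> by (simp add: \<kappa>_def)
  finally show False
    by simp
qed

end

section \<open>Lyapunov functions and the weak Sard property\<close>

lemma two_cluster_values:
  fixes y :: "nat \<Rightarrow> real"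
  assumes y: "bounded (range y)" and "\<not> convergent y"
  obtains l u where "l < u" "\<And>z K. l < z \<Longrightarrow> \<exists>k\<ge>K. y k < z" "\<And>z K. z < u \<Longrightarrow> \<exists>k\<ge>K. z < y k"
proof -
  obtain l1 r1 where 1: "strict_mono (r1 :: nat \<Rightarrow> nat)" "(y \<circ> r1) \<longlonglongrightarrow> l1"
    using bounded_imp_convergent_subsequence[OF y] by blast
  have "\<not> y \<longlonglongrightarrow> l1"
    using assms(2) convergentI by blast
  then obtain \<epsilon> where \<epsilon>: "\<epsilon> > 0" "\<And>K. \<exists>k\<ge>K. \<epsilon> \<le> dist (y k) l1"
    unfolding lim_sequentially by (meson not_less)
  obtain r2 where r2: "strict_mono (r2 :: nat \<Rightarrow> nat)" "\<And>n. \<epsilon> \<le> dist (y (r2 n)) l1"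
    using strict_mono_selection[of "\<lambda>n k. \<epsilon> \<le> dist (y k) l1", OF \<epsilon>(2)] by blast
  have "bounded (range (y \<circ> r2))"
    using y by (rule bounded_subset) auto
  then obtain l2 r3 where r3: "strict_mono (r3 :: nat \<Rightarrow> nat)" "(y \<circ> r2 \<circ> r3) \<longlonglongrightarrow> l2"
    using bounded_imp_convergent_subsequence by blast
  have 2: "strict_mono (r2 \<circ> r3)" "(y \<circ> (r2 \<circ> r3)) \<longlonglongrightarrow> l2"
    using strict_mono_o[OF r2(1) r3(1)] r3(2) by (simp_all add: o_assoc)
  have "\<epsilon> \<le> dist l2 l1"
    by (rule LIMSEQ_le_const[OF tendsto_dist[OF r3(2) tendsto_const]]) (use r2(2) in auto)
  then have "l1 \<noteq> l2"
    using \<epsilon>(1) by auto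
  have low: "\<exists>k\<ge>K. y k < z" if r: "strict_mono (r :: nat \<Rightarrow> nat)" "(y \<circ> r) \<longlonglongrightarrow> l" "l < z" for r l z K
  proof -
    have "\<forall>\<^sub>F n in sequentially. y (r n) < z \<and> K \<le> n"
      using order_tendstoD(2)[OF r(2,3)] eventually_ge_at_top[of K] by (auto intro: eventually_conj)
    then obtain n where "y (r n) < z" "K \<le> n"
      using eventually_happens[of _ sequentially] by auto
    then show ?thesis
      using seq_suble[OF r(1), of n] by (meson le_trans)
  qed
  have high: "\<exists>k\<ge>K. z < y k" if r: "strict_mono (r :: nat \<Rightarrow> nat)" "(y \<circ> r) \<longlonglongrightarrow> u" "z < u" for r u z K
  proof -
    have "\<forall>\<^sub>F n in sequentially. z < y (r n) \<and> K \<le> n"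
      using order_tendstoD(1)[OF r(2,3)] eventually_ge_at_top[of K] by (auto intro: eventually_conj)
    then obtain n where "z < y (r n)" "K \<le> n"
      using eventually_happens[of _ sequentially] by auto
    then show ?thesis
      using seq_suble[OF r(1), of n] by (meson le_trans)
  qed
  show thesis
  proof (cases "l1 < l2")
    case True
    then show ?thesis
      by (rule that) (use low[OF 1] high[OF 2] in auto)
  next
    case False
    then have "l2 < l1"
      using \<open>l1 \<noteq> l2\<close> by simp
    then show ?thesis
      by (rule that) (use low[OF 2] high[OF 1] in auto)
  qed
qed

text \<open>
  Take any index with a high value after a low one, and the last index up to there at which the
  sequence is at most \<open>a\<close>.
\<close>

lemma upcrossing:
  fixes y :: "nat \<Rightarrow> real"
  assumes "\<exists>k\<ge>K. y k < a" "\<And>K. \<exists>k\<ge>K. b < y k" "a < b"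
  obtains p q where "K \<le> p" "p < q" "y p \<le> a" "b < y q" "\<And>j. p < j \<Longrightarrow> j \<le> q \<Longrightarrow> a < y j"
proof -
  obtain k where k: "K \<le> k" "y k < a"
    using assms(1) by blast
  obtain q where q: "k \<le> q" "b < y q"
    using assms(2) by blast
  define A where "A = {j. j \<le> q \<and> y j \<le> a}"
  have A: "finite A" "k \<in> A"
    using k q by (auto simp: A_def)
  define p where "p = Max A"
  have "p \<in> A" and upper: "\<And>j. j \<in> A \<Longrightarrow> j \<le> p"
    using A by (auto simp: p_def intro: Max_in)
  then have "p \<le> q" "y p \<le> a"
    by (auto simp: A_def)
  moreover have "p \<noteq> q"
    using q(2) \<open>y p \<le> a\<close> assms(3) by auto
  moreover have "a < y j" if "p < j" "j \<le> q" for j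
    using upper[of j] that by (force simp: A_def)
  moreover have "K \<le> p"
    using upper[OF A(2)] k(1) by simp
  ultimately show thesis
    using that q(2) by (metis le_neq_implies_less)
qed

text \<open>
  The chain rule says that \<open>Q\<close> acts as a conservative field for \<open>g\<close> along Lipschitz curves in \<open>X\<close>.
  Hence \<open>g\<close> decreases at rate \<open>(norm v)\<^sup>2\<close> along solutions of the inclusion, where \<open>v\<close> is the velocity.
\<close>

locale lyapunov_inclusion = perturbed_inclusion +
  fixes X :: "'a set" and g :: "'a \<Rightarrow> real"
  assumes X_closed: "closed X" and x_in_X: "x k \<in> X" and g: "locally_lipschitz g"
    and chain_rule: "L-lipschitz_on UNIV \<gamma> \<Longrightarrow> range \<gamma> \<subseteq> X \<Longrightarrow>
      \<exists>N. negligible N \<and> (\<forall>t>0. t \<notin> N \<longrightarrow> (\<exists>v. (\<gamma> has_vector_derivative v) (at t) \<and>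
            (\<forall>q\<in>Q (\<gamma> t). ((\<lambda>t. g (\<gamma> t)) has_real_derivative q \<bullet> v) (at t))))"
begin

lemma tendsto_g: "(z \<longlongrightarrow> a) F \<Longrightarrow> ((\<lambda>n. g (z n)) \<longlongrightarrow> g a) F"
  using locally_lipschitz_continuous[OF g] by (auto intro: continuous_on_tendsto_compose)

text \<open>
  At almost every time \<open>- v\<close> itself is admissible in the chain rule, so \<open>(g \<circ> \<gamma>)' = - v \<bullet> v\<close>. If \<open>g\<close> did
  not strictly decrease over the unit interval, the velocity would vanish almost everywhere, the curve
  would rest at its starting point, and \<open>0 = - v\<close> would make that point critical.
\<close>

lemma descent:
  assumes sh: "shadows i \<gamma>" and i: "filterlim i at_top sequentially"
    and \<gamma>: "L-lipschitz_on UNIV \<gamma>" and clamp: "\<And>t. \<gamma> t = \<gamma> (max 0 (min 1 t))"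
    and noncritical: "0 \<notin> Q (\<gamma> 0)"
  shows "0 \<le> t \<Longrightarrow> t \<le> 1 \<Longrightarrow> g (\<gamma> t) \<le> g (\<gamma> 0)" and "g (\<gamma> 1) < g (\<gamma> 0)"
proof -
  have "\<gamma> t \<in> X" if "0 \<le> t" "t \<le> 1" for t
    using closed_sequentially[OF X_closed _ shadows_limit[OF sh i \<gamma> that]] x_in_X by blast
  then have "\<gamma> t \<in> X" for t
    by (subst clamp) auto
  then obtain N where N: "negligible N" "\<And>t. t > 0 \<Longrightarrow> t \<notin> N \<Longrightarrow>
      \<exists>v. (\<gamma> has_vector_derivative v) (at t) \<and>
        (\<forall>q\<in>Q (\<gamma> t). ((\<lambda>t. g (\<gamma> t)) has_real_derivative q \<bullet> v) (at t))"
    using chain_rule[OF \<gamma>] by blast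
  have deriv: "\<exists>v. (\<gamma> has_vector_derivative v) (at t) \<and> - v \<in> Q (\<gamma> t) \<and>
      ((\<lambda>t. g (\<gamma> t)) has_real_derivative (- v) \<bullet> v) (at t)" if "0 < t" "t < 1" "t \<notin> N" for t
    using N(2)[of t] limit_inclusion[OF sh i \<gamma>, of t] that by (metis less_imp_le)
  have "locally_lipschitz (\<lambda>t. g (\<gamma> t))"
    using locally_lipschitz_compose[OF g lipschitz_imp_locally_lipschitz[OF \<gamma>]] by (simp add: o_def)
  then have decreasing: "g (\<gamma> t) \<le> g (\<gamma> s)" if "0 \<le> s" "s \<le> t" "t \<le> 1" for s t
  proof (rule locally_lipschitz_nonincreasing[OF _ N(1) that(2)])
    fix r assume "s < r" "r < t" "r \<notin> N"
    then have "0 < r" "r < 1"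
      using that by simp_all
    then obtain v :: 'a where "((\<lambda>t. g (\<gamma> t)) has_real_derivative (- v) \<bullet> v) (at r)"
      using deriv \<open>r \<notin> N\<close> by blast
    moreover have "(- v) \<bullet> v \<le> 0"
      by simp
    ultimately show "\<exists>D\<le>0. ((\<lambda>t. g (\<gamma> t)) has_real_derivative D) (at r)"
      by blast
  qed
  then show "g (\<gamma> t) \<le> g (\<gamma> 0)" if "0 \<le> t" "t \<le> 1" for t
    using that by simp
  show "g (\<gamma> 1) < g (\<gamma> 0)"
  proof (rule ccontr)
    assume "\<not> g (\<gamma> 1) < g (\<gamma> 0)"
    then have const: "g (\<gamma> t) = g (\<gamma> 0)" if "0 \<le> t" "t \<le> 1" for t
      using decreasing[of 0 t] decreasing[of t 1] that by simp
    have stationary: "(\<gamma> has_vector_derivative 0) (at t)" "0 \<in> Q (\<gamma> t)"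
      if t: "0 < t" "t < 1" "t \<notin> N" for t
    proof -
      obtain v where v: "(\<gamma> has_vector_derivative v) (at t)" "- v \<in> Q (\<gamma> t)"
        "((\<lambda>t. g (\<gamma> t)) has_real_derivative (- v) \<bullet> v) (at t)"
        using deriv[OF t] by blast
      have "(- v) \<bullet> v = 0"
      proof (rule DERIV_local_const[OF v(3)])
        show "0 < min t (1 - t)"
          using t by simp
        show "\<forall>s. \<bar>t - s\<bar> < min t (1 - t) \<longrightarrow> g (\<gamma> t) = g (\<gamma> s)"
        proof (intro allI impI)
          fix s assume "\<bar>t - s\<bar> < min t (1 - t)"
          then have "0 \<le> s" "s \<le> 1"
            by linarith+
          then show "g (\<gamma> t) = g (\<gamma> s)"
            using const[of s] const[of t] t by simp
        qed
      qed
      then have "v = 0"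
        by simp
      then show "(\<gamma> has_vector_derivative 0) (at t)" "0 \<in> Q (\<gamma> t)"
        using v(1,2) by simp_all
    qed
    have "\<not> negligible {0<..<1::real}"
      using negligible_interval(2)[of "0::real" 1] by (simp add: box_real)
    then have "\<not> {0<..<1} \<subseteq> N"
      using negligible_subset[OF N(1)] by blast
    then obtain t where "t \<in> {0<..<1}" "t \<notin> N"
      by blast
    then have t: "0 < t" "t < 1" "t \<notin> N"
      by simp_all
    have "\<gamma> t = \<gamma> 0"
      by (rule lipschitz_curve_constant[OF \<gamma> N(1)]) (use t stationary(1) in auto)
    then show False
      using stationary(2)[OF t] noncritical by simp
  qed
qed

text \<open>
  If the values did not converge, they would climb infinitely often across some interval \<open>(a, b)\<close>
  whose lower end \<open>a\<close> is not a critical value; such an \<open>a\<close> exists since the critical values contain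
  no interval. Start a limit curve at the last iterates below \<open>a\<close> before each climb. It starts at
  level exactly \<open>a\<close>, at a noncritical point, so it never rises above \<open>a\<close> and is strictly below \<open>a\<close>
  after unit time. But the iterates stay above \<open>a\<close> until they have passed \<open>b\<close>, so either they are
  still above \<open>a\<close> after unit time or they reach \<open>b\<close> before; both contradict the shadowing.
\<close>

theorem lyapunov_values_converge:
  assumes sard: "interior (g ` {z \<in> X. 0 \<in> Q z}) = {}"
  shows "convergent (\<lambda>k. g (x k))"
proof (rule ccontr)
  assume not_conv: "\<not> convergent (\<lambda>k. g (x k))"
  have "compact (closure (range x))"
    using x_bounded by (simp add: compact_closure)
  then have "bounded (g ` closure (range x))"
    using locally_lipschitz_continuous[OF g]
    by (intro compact_imp_bounded compact_continuous_image) (auto intro: continuous_on_subset)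
  moreover have "range (\<lambda>k. g (x k)) \<subseteq> g ` closure (range x)"
    using closure_subset[of "range x"] by blast
  ultimately have "bounded (range (\<lambda>k. g (x k)))"
    by (rule bounded_subset)
  then obtain l h where lh: "l < h" and low: "\<And>z K. l < z \<Longrightarrow> \<exists>k\<ge>K. g (x k) < z"
    and high: "\<And>z K. z < h \<Longrightarrow> \<exists>k\<ge>K. z < g (x k)"
    using not_conv by (rule two_cluster_values) (rule that)
  have "\<not> {l<..<h} \<subseteq> g ` {z \<in> X. 0 \<in> Q z}"
  proof
    assume "{l<..<h} \<subseteq> g ` {z \<in> X. 0 \<in> Q z}"
    from interior_maximal[OF this open_greaterThanLessThan] show False
      using lh by (simp add: sard)
  qed
  then obtain a where "a \<in> {l<..<h}" and a: "a \<notin> g ` {z \<in> X. 0 \<in> Q z}"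
    by blast
  then have "l < a" "a < h"
    by simp_all
  then obtain b where b: "a < b" "b < h"
    using dense by blast
  have crossing: "\<exists>p\<ge>K. g (x p) \<le> a \<and>
      (\<exists>q>p. b < g (x q) \<and> (\<forall>j. p < j \<longrightarrow> j \<le> q \<longrightarrow> a < g (x j)))" for K
  proof -
    obtain p q where "K \<le> p" "p < q" "g (x p) \<le> a" "b < g (x q)" "\<And>j. p < j \<Longrightarrow> j \<le> q \<Longrightarrow> a < g (x j)"
      using low[OF \<open>l < a\<close>] high[OF b(2)] b(1) by (rule upcrossing) (rule that)
    then show ?thesis
      by blast
  qed
  obtain p where p: "strict_mono (p :: nat \<Rightarrow> nat)" and p_cross: "\<And>n. g (x (p n)) \<le> a \<and>
      (\<exists>q>p n. b < g (x q) \<and> (\<forall>j. p n < j \<longrightarrow> j \<le> q \<longrightarrow> a < g (x j)))"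
    using strict_mono_selection[of "\<lambda>n p. g (x p) \<le> a \<and>
      (\<exists>q>p. b < g (x q) \<and> (\<forall>j. p < j \<longrightarrow> j \<le> q \<longrightarrow> a < g (x j)))"] crossing by blast
  have "bounded (range (x \<circ> p))"
    using x_bounded by (rule bounded_subset) auto
  then obtain z s where s: "strict_mono (s :: nat \<Rightarrow> nat)" and z: "(x \<circ> p \<circ> s) \<longlonglongrightarrow> z"
    using bounded_imp_convergent_subsequence by blast
  have "(x \<circ> (p \<circ> s)) \<longlonglongrightarrow> z"
    using z by (simp add: o_assoc)
  then obtain s' \<gamma> L where s': "strict_mono s'" and \<gamma>: "L-lipschitz_on UNIV \<gamma>" "\<gamma> 0 = z"
    and sh: "shadows (p \<circ> s \<circ> s') \<gamma>" and clamp: "\<And>t. \<gamma> t = \<gamma> (max 0 (min 1 t))"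
    by (rule limit_curve[OF strict_mono_o[OF p s]]) (rule that)
  define i where "i = p \<circ> s \<circ> s'"
  have i_mono: "strict_mono i"
    unfolding i_def using p s s' by (intro strict_mono_o)
  then have i: "filterlim i at_top sequentially"
    by (rule filterlim_subseq)
  have x_i: "(\<lambda>n. x (i n)) \<longlonglongrightarrow> z"
    using LIMSEQ_subseq_LIMSEQ[OF z s'] by (simp add: i_def o_def)
  have "(\<lambda>n. x (Suc (i n)) - x (i n)) \<longlonglongrightarrow> 0"
    using filterlim_compose[OF consecutive_difference i] .
  from tendsto_add[OF this x_i] have x_Suc_i: "(\<lambda>n. x (Suc (i n))) \<longlonglongrightarrow> z"
    by simp
  have i_cross: "g (x (i n)) \<le> a"
    "\<exists>q>i n. b < g (x q) \<and> (\<forall>j. i n < j \<longrightarrow> j \<le> q \<longrightarrow> a < g (x j))" for n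
    using p_cross by (simp_all add: i_def)
  then obtain q where q: "\<And>n. i n < q n" "\<And>n. b < g (x (q n))"
    "\<And>n j. i n < j \<Longrightarrow> j \<le> q n \<Longrightarrow> a < g (x j)"
    by metis
  have "g z \<le> a"
    by (rule LIMSEQ_le_const2[OF tendsto_g[OF x_i]]) (use i_cross in auto)
  moreover have "a \<le> g z"
    by (rule LIMSEQ_le_const[OF tendsto_g[OF x_Suc_i]]) (meson Suc_leI less_imp_le lessI q(1,3))
  ultimately have gz: "g z = a"
    by simp
  have "z \<in> X"
    using closed_sequentially[OF X_closed _ x_i] x_in_X by blast
  then have "0 \<notin> Q (\<gamma> 0)"
    using a gz \<gamma>(2) by blast
  note desc = descent[OF sh[folded i_def] i \<gamma>(1) clamp this, unfolded \<gamma>(2) gz]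
  let ?e = "\<lambda>n. index_after (i n) 1"
  have "(\<lambda>n. g (x (?e n))) \<longlonglongrightarrow> g (\<gamma> 1)"
    by (intro tendsto_g shadows_limit[OF sh[folded i_def] i \<gamma>(1)]) auto
  then have "\<forall>\<^sub>F n in sequentially. g (x (?e n)) < a"
    using desc(2) by (rule order_tendstoD)
  moreover have "\<forall>\<^sub>F n in sequentially. 0 < \<sigma> (?e n) - \<sigma> (i n)"
    by (rule order_tendstoD(1)[OF index_after_lims(2)[OF i]]) auto
  ultimately have before: "\<forall>\<^sub>F n in sequentially. \<sigma> (q n) \<le> \<sigma> (i n) + 1"
  proof eventually_elim
    case (elim n)
    then have "i n < ?e n"
      by (simp add: strict_mono_less[OF time_strict_mono])
    then have "q n < ?e n"
      using q(3)[of n "?e n"] elim(1) by force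
    then show ?case
      using index_after(2)[of 1 "i n"] by (simp add: time_le_iff[symmetric, of "q n"] less_imp_le
          strict_mono_less[OF time_strict_mono, symmetric])
  qed
  \<comment> \<open>The clamping only matters for the finitely many \<open>n\<close> with \<open>\<sigma> (q n) > \<sigma> (i n) + 1\<close>; it keeps the
    whole sequence in a compact interval.\<close>
  define \<tau> where "\<tau> n = max 0 (min 1 (\<sigma> (q n) - \<sigma> (i n)))" for n
  have "compact {0..1::real}" "\<forall>n. \<tau> n \<in> {0..1}"
    by (auto simp: \<tau>_def)
  then obtain \<tau>' s'' where \<tau>': "\<tau>' \<in> {0..1}" "strict_mono (s'' :: nat \<Rightarrow> nat)" "(\<tau> \<circ> s'') \<longlonglongrightarrow> \<tau>'"
    unfolding compact_def by blast
  have "(\<lambda>n. x (q n) - \<gamma> (\<tau> n)) \<longlonglongrightarrow> 0"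
  proof (rule tendstoI)
    fix \<epsilon> :: real assume "\<epsilon> > 0"
    then have "\<forall>\<^sub>F n in sequentially. \<forall>k\<ge>i n. \<sigma> k \<le> \<sigma> (i n) + 1 \<longrightarrow>
        dist (x k) (\<gamma> (\<sigma> k - \<sigma> (i n))) < \<epsilon>"
      using sh unfolding i_def shadows_def by blast
    with before show "\<forall>\<^sub>F n in sequentially. dist (x (q n) - \<gamma> (\<tau> n)) 0 < \<epsilon>"
    proof eventually_elim
      case (elim n)
      then show ?case
        using q(1)[of n] time_le_iff[of "i n" "q n"] by (simp add: \<tau>_def dist_norm)
    qed
  qed
  then have "(\<lambda>n. x (q (s'' n)) - \<gamma> (\<tau> (s'' n))) \<longlonglongrightarrow> 0"
    using LIMSEQ_subseq_LIMSEQ[OF _ \<tau>'(2)] by (fastforce simp: o_def)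
  moreover have "(\<lambda>n. \<gamma> (\<tau> (s'' n))) \<longlonglongrightarrow> \<gamma> \<tau>'"
    using lipschitz_on_continuous_on[OF \<gamma>(1)] \<tau>'(3)
    by (auto intro: continuous_on_tendsto_compose simp: o_def)
  ultimately have "(\<lambda>n. x (q (s'' n))) \<longlonglongrightarrow> \<gamma> \<tau>'"
    using tendsto_add by fastforce
  then have "b \<le> g (\<gamma> \<tau>')"
    by (intro LIMSEQ_le_const[OF tendsto_g]) (use q(2) less_imp_le in auto)
  moreover have "g (\<gamma> \<tau>') \<le> a"
    using desc(1) \<tau>'(1) by simp
  ultimately show False
    using b(1) by simp
qed

text \<open>
  Along a limit curve started at a cluster point, \<open>g\<close> is constantly equal to the limit of the values,
  whereas from a noncritical point it would have to decrease.
\<close>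

theorem cluster_points_critical:
  assumes conv: "convergent (\<lambda>k. g (x k))" and r: "strict_mono r" "(x \<circ> r) \<longlonglongrightarrow> a"
  shows "0 \<in> Q a"
proof (rule ccontr)
  assume a: "0 \<notin> Q a"
  obtain l where l: "(\<lambda>k. g (x k)) \<longlonglongrightarrow> l"
    using conv unfolding convergent_def by blast
  obtain s \<gamma> L where s: "strict_mono s" and \<gamma>: "L-lipschitz_on UNIV \<gamma>" "\<gamma> 0 = a"
    and sh: "shadows (r \<circ> s) \<gamma>" and clamp: "\<And>t. \<gamma> t = \<gamma> (max 0 (min 1 t))"
    using r by (rule limit_curve) (rule that)
  have i: "filterlim (r \<circ> s) at_top sequentially"
    using strict_mono_o[OF r(1) s] by (rule filterlim_subseq)
  have "(\<lambda>n. g (x (index_after ((r \<circ> s) n) t))) \<longlonglongrightarrow> g (\<gamma> t)" if "0 \<le> t" "t \<le> 1" for t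
    using that by (intro tendsto_g shadows_limit[OF sh i \<gamma>(1)])
  moreover have "(\<lambda>n. g (x (index_after ((r \<circ> s) n) t))) \<longlonglongrightarrow> l" if "0 \<le> t" for t
    by (rule filterlim_compose[OF l index_after_lims(1)[OF i that]])
  ultimately have "g (\<gamma> t) = l" if "0 \<le> t" "t \<le> 1" for t
    using that LIMSEQ_unique by blast
  then have "g (\<gamma> 0) = g (\<gamma> 1)"
    by simp
  then show False
    using descent(2)[OF sh i \<gamma>(1) clamp] a \<gamma>(2) by simp
qed

end

section \<open>Conservative maps and normal cones\<close>

lemma compact_values:
  fixes D :: "'a::metric_space \<Rightarrow> 'm::heine_borel set"
  assumes "locally_bounded_map D" "graph_closed D"
  shows "compact (D z)"
proof -
  obtain r where "r > 0" "bounded (\<Union>y\<in>ball z r. D y)"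
    using assms(1) unfolding locally_bounded_map_def by blast
  moreover have "D z \<subseteq> (\<Union>y\<in>ball z r. D y)"
    using \<open>r > 0\<close> centre_in_ball by blast
  ultimately have "bounded (D z)"
    using bounded_subset by blast
  moreover have "closed ((\<lambda>J. (z, J)) -` {(x, J). J \<in> D x})"
    using assms(2) unfolding graph_closed_def by (rule closed_vimage) (intro continuous_intros)
  ultimately show ?thesis
    by (simp add: compact_eq_bounded_closed vimage_def)
qed

lemma bounded_values_on_compact:
  assumes D: "locally_bounded_map D" and "compact K"
  shows "bounded (\<Union>z\<in>K. D z)"
proof -
  have "\<forall>z. \<exists>r>0. bounded (\<Union>y\<in>ball z r. D y)"
    using D unfolding locally_bounded_map_def .
  then obtain r where r: "\<And>z. r z > 0" "\<And>z. bounded (\<Union>y\<in>ball z (r z). D y)"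
    by metis
  have "K \<subseteq> (\<Union>z\<in>K. ball z (r z))"
    using r(1) by force
  then obtain C where C: "C \<subseteq> K" "finite C" "K \<subseteq> (\<Union>z\<in>C. ball z (r z))"
    by (rule compactE_image[OF \<open>compact K\<close> open_ball]) (rule that)
  have "bounded (\<Union>z\<in>C. \<Union>y\<in>ball z (r z). D y)"
    using C(2) r(2) by (intro bounded_UN) auto
  then show ?thesis
    by (rule bounded_subset) (use C(3) in blast)
qed

lemma expansion_witness:
  fixes D :: "'a::real_normed_vector \<Rightarrow> 'm::heine_borel set"
  assumes "locally_bounded_map D" "graph_closed D" "D z \<noteq> {}" and "infdist w (D z) \<le> \<delta>"
  shows "\<exists>w'\<in>D z. dist w w' \<le> \<delta>"
proof -
  obtain w' where "w' \<in> D z" "infdist w (D z) = dist w w'"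
    using compact_imp_closed[OF compact_values[OF assms(1,2)]] assms(3)
    by (rule infdist_attains_inf) (rule that)
  then show ?thesis
    using assms(4) by auto
qed

lemma expansion_bounded:
  fixes D :: "'a::{real_normed_vector,heine_borel} \<Rightarrow> 'm::{real_normed_vector,heine_borel} set"
  assumes D: "locally_bounded_map D" "graph_closed D" "\<And>z. D z \<noteq> {}"
    and x: "bounded (range x)" and \<delta>: "\<delta> \<longlonglongrightarrow> 0" and w: "\<And>k. w k \<in> expansion (\<delta> k) D (x k)"
  shows "bounded (range w)"
proof -
  have "bounded (range \<delta>)"
    using \<delta> by (rule convergent_imp_bounded)
  then obtain B C where B: "\<And>k. norm (x k) \<le> B" and C: "\<And>k. norm (\<delta> k) \<le> C"
    using x unfolding bounded_iff by blast
  have "bounded (\<Union>z\<in>cball 0 (B + C). D z)"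
    by (rule bounded_values_on_compact[OF D(1)]) simp
  then obtain M where M: "\<And>z v. z \<in> cball 0 (B + C) \<Longrightarrow> v \<in> D z \<Longrightarrow> norm v \<le> M"
    unfolding bounded_iff by blast
  have "norm (w k) \<le> M + C" for k
  proof -
    obtain z where z: "norm (z - x k) \<le> \<delta> k" "infdist (w k) (D z) \<le> \<delta> k"
      using w[of k] unfolding expansion_def by blast
    then obtain v where v: "v \<in> D z" "dist (w k) v \<le> \<delta> k"
      using expansion_witness[OF D] by blast
    have "norm z \<le> B + C"
      using z(1) B[of k] C[of k] norm_triangle_sub[of z "x k"] by simp
    then have "norm v \<le> M"
      using M v(1) by simp
    then show ?thesis
      using v(2) C[of k] norm_triangle_sub[of "w k" v] by (simp add: dist_norm)
  qed
  then show ?thesis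
    unfolding bounded_iff by blast
qed

lemma expansion_limit:
  fixes D :: "'a::real_normed_vector \<Rightarrow> 'm::heine_borel set"
  assumes D: "locally_bounded_map D" "graph_closed D" "\<And>z. D z \<noteq> {}"
    and x: "x \<longlonglongrightarrow> a" and \<delta>: "\<delta> \<longlonglongrightarrow> 0" and w: "\<And>k. w k \<in> expansion (\<delta> k) D (x k)" "w \<longlonglongrightarrow> b"
  shows "b \<in> D a"
proof -
  have "\<exists>z v. norm (z - x k) \<le> \<delta> k \<and> v \<in> D z \<and> dist (w k) v \<le> \<delta> k" for k
  proof -
    obtain z where z: "norm (z - x k) \<le> \<delta> k" "infdist (w k) (D z) \<le> \<delta> k"
      using w(1)[of k] unfolding expansion_def by blast
    then obtain v where "v \<in> D z" "dist (w k) v \<le> \<delta> k"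
      using expansion_witness[OF D] by blast
    then show ?thesis
      using z(1) by blast
  qed
  then obtain z v where zv: "\<And>k. norm (z k - x k) \<le> \<delta> k" "\<And>k. v k \<in> D (z k)" "\<And>k. dist (w k) (v k) \<le> \<delta> k"
    by metis
  have "(\<lambda>k. z k - x k) \<longlonglongrightarrow> 0"
    by (rule Lim_null_comparison[OF _ \<delta>]) (simp add: zv(1))
  from tendsto_add[OF this x] have "z \<longlonglongrightarrow> a"
    by simp
  moreover have "v \<longlonglongrightarrow> b"
  proof -
    have "(\<lambda>k. dist (w k) b + \<delta> k) \<longlonglongrightarrow> 0 + 0"
      by (intro tendsto_add \<delta> tendsto_dist_iff[THEN iffD1, OF w(2)])
    then have bound: "(\<lambda>k. dist (w k) b + \<delta> k) \<longlonglongrightarrow> 0"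
      by simp
    have "dist (v k) b \<le> dist (w k) b + \<delta> k" for k
      using dist_triangle3[of "v k" b "w k"] zv(3)[of k] by linarith
    then have "(\<lambda>k. dist (v k) b) \<longlonglongrightarrow> 0"
      by (intro tendsto_sandwich[OF _ _ tendsto_const bound] always_eventually allI) simp_all
    then show ?thesis
      by (rule tendsto_dist_iff[THEN iffD2])
  qed
  ultimately have lim: "(\<lambda>k. (z k, v k)) \<longlonglongrightarrow> (a, b)"
    by (rule tendsto_Pair)
  have "(a, b) \<in> {(x, J). J \<in> D x}"
    by (rule closed_sequentially[OF D(2)[unfolded graph_closed_def] _ lim]) (simp add: zv(2))
  then show ?thesis
    by simp
qed

lemma lipschitz_absolutely_continuous:
  assumes \<gamma>: "L-lipschitz_on UNIV \<gamma>"
  shows "absolutely_continuous_curve \<gamma>"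
  unfolding absolutely_continuous_curve_def absolutely_continuous_interval_def
proof (intro allI impI)
  fix b \<epsilon> :: real assume "\<epsilon> > 0"
  have "L \<ge> 0"
    using \<gamma> by (rule lipschitz_on_nonneg)
  show "\<exists>\<delta>>0. \<forall>N s t. (\<forall>i<N. 0 \<le> s i \<and> s i \<le> t i \<and> t i \<le> b) \<longrightarrow>
      disjoint_family_on (\<lambda>i. {s i<..<t i}) {..<N::nat} \<longrightarrow> (\<Sum>i<N. t i - s i) < \<delta> \<longrightarrow>
      (\<Sum>i<N. norm (\<gamma> (t i) - \<gamma> (s i))) < \<epsilon>"
  proof (intro exI[of _ "\<epsilon> / (L + 1)"] conjI allI impI)
    fix N :: nat and s t :: "nat \<Rightarrow> real"
    assume st: "\<forall>i<N. 0 \<le> s i \<and> s i \<le> t i \<and> t i \<le> b" and small: "(\<Sum>i<N. t i - s i) < \<epsilon> / (L + 1)"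
    have "(\<Sum>i<N. norm (\<gamma> (t i) - \<gamma> (s i))) \<le> (\<Sum>i<N. L * (t i - s i))"
    proof (rule sum_mono)
      fix i assume "i \<in> {..<N}"
      then show "norm (\<gamma> (t i) - \<gamma> (s i)) \<le> L * (t i - s i)"
        using lipschitz_onD[OF \<gamma>, of "t i" "s i"] st by (simp add: dist_norm)
    qed
    also have "\<dots> = L * (\<Sum>i<N. t i - s i)"
      by (simp add: sum_distrib_left)
    also have "\<dots> \<le> L * (\<epsilon> / (L + 1))"
      using small \<open>L \<ge> 0\<close> by (intro mult_left_mono) auto
    also have "\<dots> < \<epsilon>"
      using \<open>\<epsilon> > 0\<close> \<open>L \<ge> 0\<close> by (simp add: field_simps)
    finally show "(\<Sum>i<N. norm (\<gamma> (t i) - \<gamma> (s i))) < \<epsilon>" .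
  qed (use \<open>\<epsilon> > 0\<close> \<open>L \<ge> 0\<close> in auto)
qed

lemma conservative_off_negligible:
  fixes app :: "'m::metric_space \<Rightarrow> 'a::real_normed_vector \<Rightarrow> 'b::real_normed_vector"
  assumes "conservative_map app H D" "absolutely_continuous_curve \<gamma>"
  obtains N where "negligible N" "\<And>t. t > 0 \<Longrightarrow> t \<notin> N \<Longrightarrow> \<exists>v. (\<gamma> has_vector_derivative v) (at t) \<and>
    (\<forall>J\<in>D (\<gamma> t). ((\<lambda>t. H (\<gamma> t)) has_vector_derivative app J v) (at t))"
proof -
  have "AE t in lebesgue_on {0..}. \<exists>v. (\<gamma> has_vector_derivative v) (at t within {0..}) \<and>
      (\<forall>J\<in>D (\<gamma> t). ((H \<circ> \<gamma>) has_vector_derivative app J v) (at t within {0..}))"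
    using assms unfolding conservative_map_def by blast
  then have "AE t in lebesgue. t \<in> {0..} \<longrightarrow> (\<exists>v. (\<gamma> has_vector_derivative v) (at t within {0..}) \<and>
      (\<forall>J\<in>D (\<gamma> t). ((H \<circ> \<gamma>) has_vector_derivative app J v) (at t within {0..})))"
    by (subst (asm) AE_restrict_space_iff) simp_all
  then obtain N where "N \<in> null_sets lebesgue"
    and N: "\<And>t. t \<in> {0..} \<Longrightarrow> t \<notin> N \<Longrightarrow> \<exists>v. (\<gamma> has_vector_derivative v) (at t within {0..}) \<and>
      (\<forall>J\<in>D (\<gamma> t). ((H \<circ> \<gamma>) has_vector_derivative app J v) (at t within {0..}))"
    by (rule AE_E3) (rule that, auto)
  show thesis
  proof
    show "negligible N"
      using \<open>N \<in> null_sets lebesgue\<close> by (simp add: negligible_iff_null_sets)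
    fix t :: real assume t: "t > 0" "t \<notin> N"
    have "at t within {0..} = at t"
      by (rule at_within_interior) (use t(1) in \<open>simp add: interior_real_atLeast\<close>)
    then show "\<exists>v. (\<gamma> has_vector_derivative v) (at t) \<and>
        (\<forall>J\<in>D (\<gamma> t). ((\<lambda>t. H (\<gamma> t)) has_vector_derivative app J v) (at t))"
      using N[of t] t by (simp add: o_def)
  qed
qed

text \<open>
  For single elements \<open>d\<close>, \<open>J\<close>, \<open>u\<close> the chain rule holds because it does for each of the three
  summands of the penalty, for the norm of the constraint off the isolated zeros. All resulting
  vectors therefore have the same inner product with the velocity; they lie in one hyperplane, which
  then contains their convex hull as well.
\<close>

lemma penalty_chain_rule:
  fixes f :: "real^'n \<Rightarrow> real" and c :: "real^'n \<Rightarrow> real^'p" and \<gamma> :: "real \<Rightarrow> real^'n"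
  assumes f: "conservative_field f Df" and c: "conservative_jacobian c Dc"
    and \<gamma>: "absolutely_continuous_curve \<gamma>"
  obtains N where "negligible N" "\<And>t. t > 0 \<Longrightarrow> t \<notin> N \<Longrightarrow> \<exists>v. (\<gamma> has_vector_derivative v) (at t) \<and>
    (\<forall>q\<in>penalty_field Df c Dc \<beta> \<rho> (\<gamma> t).
      ((\<lambda>t. penalty f c \<beta> \<rho> (\<gamma> t)) has_real_derivative q \<bullet> v) (at t))"
proof -
  obtain N1 where N1: "negligible N1" "\<And>t. t > 0 \<Longrightarrow> t \<notin> N1 \<Longrightarrow> \<exists>v. (\<gamma> has_vector_derivative v) (at t) \<and>
      (\<forall>d\<in>Df (\<gamma> t). ((\<lambda>t. f (\<gamma> t)) has_vector_derivative d \<bullet> v) (at t))"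
    using f[unfolded conservative_field_def, THEN conjunct2] \<gamma>
    by (rule conservative_off_negligible) (rule that)
  obtain N2 where N2: "negligible N2" "\<And>t. t > 0 \<Longrightarrow> t \<notin> N2 \<Longrightarrow> \<exists>v. (\<gamma> has_vector_derivative v) (at t) \<and>
      (\<forall>J\<in>Dc (\<gamma> t). ((\<lambda>t. c (\<gamma> t)) has_vector_derivative transpose J *v v) (at t))"
    using c[unfolded conservative_jacobian_def, THEN conjunct2] \<gamma>
    by (rule conservative_off_negligible) (rule that)
  define Z where "Z = {t. c (\<gamma> t) = 0}"
  define N3 where "N3 = {t \<in> Z. \<not> t islimpt Z}"
  have "countable N3"
    unfolding N3_def by (rule countable_isolated_points)
  then have "negligible (\<Union>((\<lambda>t. {t}) ` N3))"
    by (intro negligible_countable_Union countable_image) auto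
  then have "negligible N3"
    by simp
  show thesis
  proof
    show "negligible (N1 \<union> N2 \<union> N3)"
      using N1(1) N2(1) \<open>negligible N3\<close> by simp
    fix t :: real assume t: "t > 0" "t \<notin> N1 \<union> N2 \<union> N3"
    obtain v where v: "(\<gamma> has_vector_derivative v) (at t)"
      and fv: "\<And>d. d \<in> Df (\<gamma> t) \<Longrightarrow> ((\<lambda>t. f (\<gamma> t)) has_real_derivative d \<bullet> v) (at t)"
      using N1(2)[of t] t by (auto simp: has_real_derivative_iff_has_vector_derivative)
    obtain v' where v': "(\<gamma> has_vector_derivative v') (at t)"
      and "\<And>J. J \<in> Dc (\<gamma> t) \<Longrightarrow> ((\<lambda>t. c (\<gamma> t)) has_vector_derivative transpose J *v v') (at t)"
      using N2(2)[of t] t by auto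
    then have cv: "((\<lambda>t. c (\<gamma> t)) has_vector_derivative transpose J *v v) (at t)" if "J \<in> Dc (\<gamma> t)" for J
      using that vector_derivative_unique_at[OF v v'] by simp
    have limit_zero: "t islimpt {s. c (\<gamma> s) = 0}" if "c (\<gamma> t) = 0"
      using t(2) that by (simp add: N3_def Z_def)
    define S where "S = Df (\<gamma> t) + {J *v (\<beta> *\<^sub>R u + \<rho> *\<^sub>R c (\<gamma> t)) |J u. J \<in> Dc (\<gamma> t) \<and> u \<in> T_regu (c (\<gamma> t))}"
    have S: "((\<lambda>t. penalty f c \<beta> \<rho> (\<gamma> t)) has_real_derivative q \<bullet> v) (at t)" if "q \<in> S" for q
    proof -
      obtain d J u where q: "q = d + J *v (\<beta> *\<^sub>R u + \<rho> *\<^sub>R c (\<gamma> t))" and mem: "d \<in> Df (\<gamma> t)" "J \<in> Dc (\<gamma> t)"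
        "u \<in> T_regu (c (\<gamma> t))"
        using \<open>q \<in> S\<close> unfolding S_def set_plus_def by blast
      let ?w = "transpose J *v v"
      have "((\<lambda>t. c (\<gamma> t) \<bullet> c (\<gamma> t)) has_derivative (\<lambda>h. c (\<gamma> t) \<bullet> (h *\<^sub>R ?w) + (h *\<^sub>R ?w) \<bullet> c (\<gamma> t))) (at t)"
        using cv[OF mem(2)] unfolding has_vector_derivative_def by (intro has_derivative_inner)
      then have sq: "((\<lambda>t. (norm (c (\<gamma> t)))\<^sup>2) has_real_derivative 2 * (c (\<gamma> t) \<bullet> ?w)) (at t)"
        unfolding has_field_derivative_def power2_norm_eq_inner
        by (rule has_derivative_eq_rhs) (auto simp: inner_commute algebra_simps)
      have "((\<lambda>t. norm (c (\<gamma> t))) has_real_derivative u \<bullet> ?w) (at t)"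
        by (rule norm_has_derivative_off_isolated_zeros[OF cv[OF mem(2)] limit_zero mem(3)])
      then have "((\<lambda>t. f (\<gamma> t) + \<beta> * norm (c (\<gamma> t)) + \<rho> / 2 * (norm (c (\<gamma> t)))\<^sup>2) has_real_derivative
          d \<bullet> v + \<beta> * (u \<bullet> ?w) + \<rho> / 2 * (2 * (c (\<gamma> t) \<bullet> ?w))) (at t)"
        by (intro DERIV_add DERIV_cmult fv[OF mem(1)] sq)
      moreover have "y \<bullet> ?w = (J *v y) \<bullet> v" for y
        by (metis dot_lmul_matrix inner_commute transpose_matrix_vector)
      then have "d \<bullet> v + \<beta> * (u \<bullet> ?w) + \<rho> / 2 * (2 * (c (\<gamma> t) \<bullet> ?w)) = q \<bullet> v"
        unfolding q by (simp add: inner_simps matrix_vector_right_distrib matrix_vector_mult_scaleR)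
      ultimately show ?thesis
        by (simp add: penalty_def)
    qed
    have "((\<lambda>t. penalty f c \<beta> \<rho> (\<gamma> t)) has_real_derivative q \<bullet> v) (at t)" if "q \<in> convex hull S" for q
    proof -
      obtain q0 where q0: "q0 \<in> S"
        using \<open>q \<in> convex hull S\<close> convex_hull_eq_empty by fastforce
      have "S \<subseteq> {q. v \<bullet> q = q0 \<bullet> v}"
        using DERIV_unique[OF S S[OF q0]] by (auto simp: inner_commute)
      then have "convex hull S \<subseteq> {q. v \<bullet> q = q0 \<bullet> v}"
        by (intro hull_minimal convex_hyperplane)
      then have "q \<bullet> v = q0 \<bullet> v"
        using that by (auto simp: inner_commute)
      then show ?thesis
        using S[OF q0] by simp
    qed
    then show "\<exists>v. (\<gamma> has_vector_derivative v) (at t) \<and> (\<forall>q\<in>penalty_field Df c Dc \<beta> \<rho> (\<gamma> t).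
        ((\<lambda>t. penalty f c \<beta> \<rho> (\<gamma> t)) has_real_derivative q \<bullet> v) (at t))"
      using v unfolding penalty_field_def S_def by blast
  qed
qed

text \<open>
  A curve in \<open>X\<close> maximises a normal functional at the base point, so the functional has derivative
  zero there. This is why adding the normal cone does not disturb the chain rule.
\<close>

lemma normal_orthogonal_to_velocity:
  assumes "range \<gamma> \<subseteq> X" and v: "(\<gamma> has_vector_derivative v) (at t)" and n: "n \<in> normal_cone X (\<gamma> t)"
  shows "n \<bullet> v = 0"
proof (rule DERIV_local_max)
  have "((\<lambda>s. n \<bullet> \<gamma> s) has_derivative (\<lambda>h. n \<bullet> (h *\<^sub>R v))) (at t)"
    using v unfolding has_vector_derivative_def by (rule has_derivative_inner_right)
  then show "((\<lambda>s. n \<bullet> \<gamma> s) has_real_derivative n \<bullet> v) (at t)"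
    unfolding has_field_derivative_def by (rule has_derivative_eq_rhs) auto
  show "\<forall>s. \<bar>t - s\<bar> < 1 \<longrightarrow> n \<bullet> \<gamma> s \<le> n \<bullet> \<gamma> t"
    using n assms(1) by (auto simp: normal_cone_def inner_diff_right)
qed simp

lemma closed_normal_cone: "closed (normal_cone X x)"
proof -
  have "normal_cone X x = (\<Inter>y\<in>X. {v. v \<bullet> (y - x) \<le> 0})"
    by (auto simp: normal_cone_def)
  moreover have "closed {v. v \<bullet> (y - x) \<le> 0}" for y
    by (intro closed_Collect_le continuous_intros)
  ultimately show ?thesis
    by auto
qed

lemma convex_normal_cone: "convex (normal_cone X x)"
proof (rule convexI)
  fix v w and s t :: real assume "v \<in> normal_cone X x" "w \<in> normal_cone X x" "0 \<le> s" "0 \<le> t"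
  then show "s *\<^sub>R v + t *\<^sub>R w \<in> normal_cone X x"
    unfolding normal_cone_def
    by (auto simp: inner_add_left intro!: add_nonpos_nonpos mult_nonneg_nonpos)
qed

lemma normal_cone_scaleR: "v \<in> normal_cone X x \<Longrightarrow> 0 \<le> s \<Longrightarrow> s *\<^sub>R v \<in> normal_cone X x"
  unfolding normal_cone_def by (auto intro!: mult_nonneg_nonpos)

lemma normal_cone_limit:
  assumes "\<And>k. v k \<in> normal_cone X (x k)" "x \<longlonglongrightarrow> a" "v \<longlonglongrightarrow> b"
  shows "b \<in> normal_cone X a"
  unfolding normal_cone_def
proof (intro CollectI ballI)
  fix y assume "y \<in> X"
  have "(\<lambda>k. v k \<bullet> (y - x k)) \<longlonglongrightarrow> b \<bullet> (y - a)"
    by (intro tendsto_intros assms)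
  then show "b \<bullet> (y - a) \<le> 0"
    by (rule LIMSEQ_le_const2) (use assms(1) \<open>y \<in> X\<close> in \<open>auto simp: normal_cone_def\<close>)
qed

lemma closest_point_residual_normal:
  fixes X :: "'a::euclidean_space set"
  assumes "closed X" "convex X" "X \<noteq> {}"
  shows "z - closest_point X z \<in> normal_cone X (closest_point X z)"
  unfolding normal_cone_def
  using any_closest_point_dot[OF assms(2,1) closest_point_in_set[OF assms(1,3)]] closest_point_le[OF assms(1)]
  by blast

lemma bounded_bilinear_matrix_vector_mult:
  "bounded_bilinear ((*v) :: real^'m^'n \<Rightarrow> real^'m \<Rightarrow> real^'n)"
proof -
  have "bilinear ((*v) :: real^'m^'n \<Rightarrow> real^'m \<Rightarrow> real^'n)"
    unfolding bilinear_def linear_iff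
    by (simp add: matrix_vector_right_distrib matrix_vector_mult_add_rdistrib matrix_vector_mult_scaleR
        scaleR_matrix_vector_assoc)
  then show ?thesis
    by (simp add: bilinear_conv_bounded_bilinear)
qed

lemmas tendsto_matrix_vector_mult = bounded_bilinear.tendsto[OF bounded_bilinear_matrix_vector_mult]

lemma compact_T_regu: "compact (T_regu (y :: 'a::euclidean_space))"
proof -
  have "{u :: 'a. norm u \<le> 1} = cball 0 1"
    by auto
  then show ?thesis
    by (simp add: T_regu_def)
qed

lemma compact_penalty_field:
  fixes f :: "real^'n \<Rightarrow> real" and c :: "real^'n \<Rightarrow> real^'p"
  assumes "conservative_field f Df" "conservative_jacobian c Dc"
  shows "compact (penalty_field Df c Dc \<beta> \<rho> z)"
proof -
  let ?F = "\<lambda>(J, u). (J :: real^'p^'n) *v (\<beta> *\<^sub>R u + \<rho> *\<^sub>R c z)"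
  have D: "compact (Df z)" "compact (Dc z)"
    using assms unfolding conservative_field_def conservative_jacobian_def conservative_map_def
    by (auto intro: compact_values)
  have "continuous_on UNIV ?F"
    unfolding split_def
    by (intro bounded_bilinear.continuous_on[OF bounded_bilinear_matrix_vector_mult] continuous_intros)
  then have "compact (?F ` (Dc z \<times> T_regu (c z)))"
    by (intro compact_continuous_image compact_Times D compact_T_regu) (rule continuous_on_subset, auto)
  moreover have "?F ` (Dc z \<times> T_regu (c z)) = {J *v (\<beta> *\<^sub>R u + \<rho> *\<^sub>R c z) |J u. J \<in> Dc z \<and> u \<in> T_regu (c z)}"
    by auto
  ultimately have "compact (Df z + {J *v (\<beta> *\<^sub>R u + \<rho> *\<^sub>R c z) |J u. J \<in> Dc z \<and> u \<in> T_regu (c z)})"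
    using compact_sums[OF D(1)] unfolding set_plus_def by (smt (verit, best) Collect_cong)
  then show ?thesis
    unfolding penalty_field_def by (rule compact_convex_hull)
qed

lemma closed_penalty_plus_normal:
  fixes f :: "real^'n \<Rightarrow> real" and c :: "real^'n \<Rightarrow> real^'p"
  assumes "conservative_field f Df" "conservative_jacobian c Dc"
  shows "closed (penalty_field Df c Dc \<beta> \<rho> z + normal_cone X z)"
proof -
  have "penalty_field Df c Dc \<beta> \<rho> z + normal_cone X z =
      (\<Union>a\<in>penalty_field Df c Dc \<beta> \<rho> z. \<Union>b\<in>normal_cone X z. {a + b})"
    by (auto simp: set_plus_def)
  then show ?thesis
    using compact_closed_sums[OF compact_penalty_field[OF assms] closed_normal_cone] by metis
qed

lemma locally_lipschitz_penalty:
  fixes f :: "real^'n \<Rightarrow> real" and c :: "real^'n \<Rightarrow> real^'p"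
  assumes f: "locally_lipschitz f" and c: "locally_lipschitz c"
  shows "locally_lipschitz (penalty f c \<beta> \<rho>)"
proof -
  have "\<bar>\<beta>\<bar>-lipschitz_on UNIV (\<lambda>y::real^'p. \<beta> * norm y)"
  proof (rule lipschitz_onI)
    fix x y :: "real^'p"
    have "\<bar>\<beta>\<bar> * \<bar>norm x - norm y\<bar> \<le> \<bar>\<beta>\<bar> * dist x y"
      unfolding dist_norm by (intro mult_left_mono norm_triangle_ineq3) simp
    then show "dist (\<beta> * norm x) (\<beta> * norm y) \<le> \<bar>\<beta>\<bar> * dist x y"
      by (simp add: dist_real_def flip: abs_mult right_diff_distrib)
  qed simp
  then have "locally_lipschitz (\<lambda>x. f x + ((\<lambda>y. \<beta> * norm y) \<circ> c) x + ((\<lambda>y. \<rho> / 2 * (norm y)\<^sup>2) \<circ> c) x)"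
    by (intro locally_lipschitz_add f locally_lipschitz_compose[OF _ c] lipschitz_imp_locally_lipschitz
        locally_lipschitz_cmult_power2_norm)
  then show ?thesis
    by (simp add: penalty_def[abs_def] o_def)
qed

section \<open>The multiplier recursion\<close>

text \<open>
  The multiplier is an exponentially weighted average of the directions \<open>\<beta> *\<^sub>R regu (y k)\<close>, up to the
  decaying influence of its initial value. Old directions are forgotten at a geometric rate, while the iterates hardly move in any fixed number of
  steps; so the multiplier tends to the current direction where \<open>y\<close> stays away from zero, and into the
  ball of radius \<open>\<beta>\<close> otherwise.
\<close>

context
  fixes \<beta> \<theta>min \<theta>max :: real and \<theta> :: "nat \<Rightarrow> real" and \<mu> y :: "nat \<Rightarrow> 'b::euclidean_space"
  assumes update: "\<mu> (Suc k) = \<mu> k + \<theta> k *\<^sub>R (regu (y (Suc k)) - (1 / \<beta>) *\<^sub>R \<mu> k)"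
    and rates: "0 < \<theta>min" "\<theta>max < \<beta>" "\<theta>min \<le> \<theta> k" "\<theta> k \<le> \<theta>max"
begin

lemma multiplier_distance:
  shows "norm (\<mu> (Suc k) - \<beta> *\<^sub>R u) \<le>
    (1 - \<theta>min / \<beta>) * norm (\<mu> k - \<beta> *\<^sub>R u) + \<theta> k * norm (regu (y (Suc k)) - u)"
proof -
  have \<beta>: "\<beta> > 0" "\<theta> k > 0" "\<theta> k < \<beta>"
    using rates(1,2) rates(3,4)[of k] by linarith+
  have "\<mu> (Suc k) - \<beta> *\<^sub>R u = (1 - \<theta> k / \<beta>) *\<^sub>R (\<mu> k - \<beta> *\<^sub>R u) + \<theta> k *\<^sub>R (regu (y (Suc k)) - u)"
    using \<beta>(1) by (simp add: update algebra_simps)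
  then have "norm (\<mu> (Suc k) - \<beta> *\<^sub>R u) \<le>
      norm ((1 - \<theta> k / \<beta>) *\<^sub>R (\<mu> k - \<beta> *\<^sub>R u)) + norm (\<theta> k *\<^sub>R (regu (y (Suc k)) - u))"
    by (metis norm_triangle_ineq)
  also have "\<dots> = (1 - \<theta> k / \<beta>) * norm (\<mu> k - \<beta> *\<^sub>R u) + \<theta> k * norm (regu (y (Suc k)) - u)"
    using \<beta> by simp
  also have "\<dots> \<le> (1 - \<theta>min / \<beta>) * norm (\<mu> k - \<beta> *\<^sub>R u) + \<theta> k * norm (regu (y (Suc k)) - u)"
    using \<beta>(1) rates(3)[of k] by (intro add_right_mono mult_right_mono) (auto simp: divide_right_mono)
  finally show ?thesis .
qed

lemma contraction_factor: "0 < 1 - \<theta>min / \<beta>" "1 - \<theta>min / \<beta> < 1" "0 < \<beta>"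
  using rates(1,2) rates(3,4)[of 0] by (simp_all add: field_simps)

lemma multiplier_bound: "norm (\<mu> k) \<le> \<beta> + (1 - \<theta>min / \<beta>) ^ k * norm (\<mu> 0)"
proof (induction k)
  case (Suc k)
  have \<beta>: "\<beta> > 0" "\<theta> k > 0" "\<theta> k < \<beta>"
    using rates(1,2) rates(3,4)[of k] by linarith+
  have "norm (regu (y (Suc k))) \<le> 1"
    by (simp add: regu_def)
  have "\<mu> (Suc k) = (1 - \<theta> k / \<beta>) *\<^sub>R \<mu> k + \<theta> k *\<^sub>R regu (y (Suc k))"
    by (simp add: update algebra_simps)
  then have "norm (\<mu> (Suc k)) \<le> norm ((1 - \<theta> k / \<beta>) *\<^sub>R \<mu> k) + norm (\<theta> k *\<^sub>R regu (y (Suc k)))"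
    by (metis norm_triangle_ineq)
  also have "\<dots> = (1 - \<theta> k / \<beta>) * norm (\<mu> k) + \<theta> k * norm (regu (y (Suc k)))"
    using \<beta> by simp
  also have "\<dots> \<le> (1 - \<theta> k / \<beta>) * (\<beta> + (1 - \<theta>min / \<beta>) ^ k * norm (\<mu> 0)) + \<theta> k * 1"
    using \<beta> Suc \<open>norm (regu (y (Suc k))) \<le> 1\<close> by (intro add_mono mult_left_mono) auto
  also have "\<dots> = \<beta> + (1 - \<theta> k / \<beta>) * ((1 - \<theta>min / \<beta>) ^ k * norm (\<mu> 0))"
    using \<beta>(1) by (simp add: field_simps)
  also have "\<dots> \<le> \<beta> + (1 - \<theta>min / \<beta>) * ((1 - \<theta>min / \<beta>) ^ k * norm (\<mu> 0))"
    using \<beta>(1) rates(3)[of k] contraction_factor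
    by (intro add_left_mono mult_right_mono diff_left_mono divide_right_mono) (auto intro: less_imp_le)
  finally show ?case
    by (simp add: mult.assoc)
qed (use contraction_factor in simp)

lemma multiplier_bounded: "bounded (range \<mu>)"
proof -
  have "norm (\<mu> k) \<le> \<beta> + norm (\<mu> 0)" for k
  proof -
    have "(1 - \<theta>min / \<beta>) ^ k * norm (\<mu> 0) \<le> 1 * norm (\<mu> 0)"
      using contraction_factor by (intro mult_right_mono power_le_one) auto
    then show ?thesis
      using multiplier_bound[of k] by linarith
  qed
  then show ?thesis
    unfolding bounded_iff by blast
qed

lemma multiplier_distance_unrolled:
  "norm (\<mu> (k + m) - \<beta> *\<^sub>R u) \<le>
    (1 - \<theta>min / \<beta>) ^ m * norm (\<mu> k - \<beta> *\<^sub>R u) + (\<Sum>j<m. \<beta> * norm (regu (y (k + m - j)) - u))"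
proof (induction m)
  case (Suc m)
  let ?q = "1 - \<theta>min / \<beta>" and ?S = "\<Sum>j<m. \<beta> * norm (regu (y (k + m - j)) - u)"
  have q: "0 \<le> ?q" "?q \<le> 1" and "\<beta> > 0"
    using contraction_factor by simp_all
  have "\<theta> (k + m) \<le> \<beta>"
    using rates(2,4) by (meson less_imp_le order_trans)
  then have last: "\<theta> (k + m) * norm (regu (y (k + Suc m)) - u) \<le> \<beta> * norm (regu (y (k + Suc m)) - u)"
    by (rule mult_right_mono) simp
  have "norm (\<mu> (k + Suc m) - \<beta> *\<^sub>R u) \<le>
      ?q * norm (\<mu> (k + m) - \<beta> *\<^sub>R u) + \<theta> (k + m) * norm (regu (y (k + Suc m)) - u)"
    using multiplier_distance[of "k + m" u] by simp
  moreover have "?q * norm (\<mu> (k + m) - \<beta> *\<^sub>R u) \<le> ?q * (?q ^ m * norm (\<mu> k - \<beta> *\<^sub>R u) + ?S)"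
    using Suc q(1) by (rule mult_left_mono)
  moreover have "?q * (?q ^ m * norm (\<mu> k - \<beta> *\<^sub>R u) + ?S) \<le> ?q ^ Suc m * norm (\<mu> k - \<beta> *\<^sub>R u) + ?S"
  proof -
    have "?S \<ge> 0"
      using \<open>\<beta> > 0\<close> by (intro sum_nonneg) auto
    then have "?q * ?S \<le> 1 * ?S"
      using q(2) by (intro mult_right_mono)
    then show ?thesis
      by (simp only: distrib_left mult.assoc power_Suc mult_1)
  qed
  moreover have "(\<Sum>j<Suc m. \<beta> * norm (regu (y (k + Suc m - j)) - u)) = ?S + \<beta> * norm (regu (y (k + Suc m)) - u)"
    by (subst sum.lessThan_Suc_shift) simp
  ultimately show ?case
    using last by linarith
qed simp

text \<open>
  For a nonzero limit \<open>b\<close>, going back \<open>m\<close> steps bounds the distance from \<open>\<beta> *\<^sub>R regu b\<close> by a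
  geometric term in \<open>m\<close> plus \<open>m\<close> errors that vanish in the limit for each fixed \<open>m\<close>; then \<open>m\<close> is
  sent to infinity.
\<close>

lemma multiplier_limit:
  assumes r: "strict_mono r" and y: "\<And>m. (\<lambda>n. y (r n - m)) \<longlonglongrightarrow> b" and l: "(\<mu> \<circ> r) \<longlonglongrightarrow> l"
  shows "\<exists>u\<in>T_regu b. l = \<beta> *\<^sub>R u"
proof (cases "b = 0")
  case True
  have "(\<lambda>k. \<beta> + (1 - \<theta>min / \<beta>) ^ k * norm (\<mu> 0)) \<longlonglongrightarrow> \<beta> + 0 * norm (\<mu> 0)"
    using contraction_factor by (intro tendsto_intros LIMSEQ_realpow_zero) auto
  then have lim: "(\<lambda>n. \<beta> + (1 - \<theta>min / \<beta>) ^ r n * norm (\<mu> 0)) \<longlonglongrightarrow> \<beta>"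
    using LIMSEQ_subseq_LIMSEQ[OF _ r] by (fastforce simp: o_def)
  have "norm l \<le> \<beta>"
    by (rule LIMSEQ_le[OF tendsto_norm[OF l] lim]) (auto simp: multiplier_bound)
  then show ?thesis
    using True contraction_factor(3) by (intro bexI[of _ "(1 / \<beta>) *\<^sub>R l"]) (auto simp: T_regu_def)
next
  case False
  define u where "u = regu b"
  have regu_sgn: "regu z = sgn z" for z :: 'b
    by (simp add: regu_def sgn_div_norm)
  obtain B where B: "\<And>k. norm (\<mu> k) \<le> B"
    using multiplier_bounded unfolding bounded_iff by blast
  have B': "norm (\<mu> k - \<beta> *\<^sub>R u) \<le> B + norm (\<beta> *\<^sub>R u)" for k
    using norm_triangle_ineq4[of "\<mu> k" "\<beta> *\<^sub>R u"] B[of k] by linarith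
  have "norm (l - \<beta> *\<^sub>R u) \<le> (1 - \<theta>min / \<beta>) ^ m * (B + norm (\<beta> *\<^sub>R u))" for m
  proof -
    have "(\<lambda>n. (1 - \<theta>min / \<beta>) ^ m * (B + norm (\<beta> *\<^sub>R u)) + (\<Sum>j<m. \<beta> * norm (regu (y (r n - j)) - u)))
        \<longlonglongrightarrow> (1 - \<theta>min / \<beta>) ^ m * (B + norm (\<beta> *\<^sub>R u)) + (\<Sum>j<m. \<beta> * norm (u - u))"
      unfolding u_def regu_sgn by (intro tendsto_intros y False)
    then have lim: "(\<lambda>n. (1 - \<theta>min / \<beta>) ^ m * (B + norm (\<beta> *\<^sub>R u)) + (\<Sum>j<m. \<beta> * norm (regu (y (r n - j)) - u)))
        \<longlonglongrightarrow> (1 - \<theta>min / \<beta>) ^ m * (B + norm (\<beta> *\<^sub>R u))"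
      by simp
    have le: "norm (\<mu> (r n) - \<beta> *\<^sub>R u) \<le>
        (1 - \<theta>min / \<beta>) ^ m * (B + norm (\<beta> *\<^sub>R u)) + (\<Sum>j<m. \<beta> * norm (regu (y (r n - j)) - u))" if "n \<ge> m" for n
    proof -
      have "m \<le> r n"
        using that seq_suble[OF r, of n] by simp
      then have "norm (\<mu> (r n) - \<beta> *\<^sub>R u) \<le> (1 - \<theta>min / \<beta>) ^ m * norm (\<mu> (r n - m) - \<beta> *\<^sub>R u) +
          (\<Sum>j<m. \<beta> * norm (regu (y (r n - j)) - u))"
        using multiplier_distance_unrolled[of "r n - m" m u] by simp
      also have "(1 - \<theta>min / \<beta>) ^ m * norm (\<mu> (r n - m) - \<beta> *\<^sub>R u) \<le>
          (1 - \<theta>min / \<beta>) ^ m * (B + norm (\<beta> *\<^sub>R u))"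
        using B' contraction_factor by (intro mult_left_mono) auto
      finally show ?thesis
        by simp
    qed
    have "(\<lambda>n. norm ((\<mu> \<circ> r) n - \<beta> *\<^sub>R u)) \<longlonglongrightarrow> norm (l - \<beta> *\<^sub>R u)"
      by (intro tendsto_intros l)
    then show ?thesis
      using lim by (rule LIMSEQ_le) (use le in auto)
  qed
  moreover have "(\<lambda>m. (1 - \<theta>min / \<beta>) ^ m * (B + norm (\<beta> *\<^sub>R u))) \<longlonglongrightarrow> 0 * (B + norm (\<beta> *\<^sub>R u))"
    using contraction_factor by (intro tendsto_intros LIMSEQ_realpow_zero) auto
  ultimately have "norm (l - \<beta> *\<^sub>R u) \<le> 0"
    by (intro LIMSEQ_le_const[of _ 0]) auto
  then show ?thesis
    using False by (intro bexI[of _ u]) (auto simp: u_def T_regu_def regu_def)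
qed

end

section \<open>KKT points and convergence of the method\<close>

text \<open>
  At an infeasible critical point the penalty field has the form \<open>d + \<kappa> *\<^sub>R (A *v c a)\<close> with
  \<open>\<kappa> \<ge> \<beta> / norm (c a)\<close>, since the subdifferential of the norm is a single direction there. Criticality
  then places \<open>- (A *v c a)\<close> within distance \<open>M / \<kappa>\<close> of the normal cone, which for \<open>\<beta> > M / \<nu>\<close> is
  less than the assumed lower bound. At a feasible point every term of the penalty field beyond \<open>Df a\<close>
  lies in the column span.
\<close>

lemma critical_point_is_kkt:
  fixes f :: "real^'n \<Rightarrow> real" and c :: "real^'n \<Rightarrow> real^'p"
  assumes a: "a \<in> critical_set X (penalty_field Df c Dc \<beta> \<rho>)"
    and convex: "convex (Df a)" "convex (Dc a)" and \<rho>: "\<rho> \<ge> 0"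
    and \<nu>: "\<nu> > 0" "\<nu> * norm (c a) \<le> setdist {- (A *v c a) |A. A \<in> Dc a} (normal_cone X a)"
    and bound: "\<And>v. v \<in> Df a \<Longrightarrow> norm v \<le> M" and \<beta>: "\<beta> > 0" "\<beta> > M / \<nu>"
  shows "kkt_point X c Df Dc a"
proof -
  have "a \<in> X" and "0 \<in> penalty_field Df c Dc \<beta> \<rho> a + normal_cone X a"
    using a unfolding critical_set_def by auto
  then obtain s n where s: "s \<in> penalty_field Df c Dc \<beta> \<rho> a" and n: "n \<in> normal_cone X a" and sn: "s + n = 0"
    by (metis set_plus_elim)
  have feasible: "c a = 0"
  proof (rule ccontr)
    assume "c a \<noteq> 0"
    define \<kappa> where "\<kappa> = \<beta> / norm (c a) + \<rho>"
    have "\<kappa> > 0"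
      using \<open>c a \<noteq> 0\<close> \<beta>(1) \<rho> by (simp add: \<kappa>_def add_pos_nonneg)
    have lin: "linear (\<lambda>A :: real^'p^'n. A *v (\<kappa> *\<^sub>R c a))"
      by (rule bounded_linear.linear[OF bounded_bilinear.bounded_linear_left[OF bounded_bilinear_matrix_vector_mult]])
    have "{J *v (\<beta> *\<^sub>R u + \<rho> *\<^sub>R c a) |J u. J \<in> Dc a \<and> u \<in> T_regu (c a)} = (\<lambda>A. A *v (\<kappa> *\<^sub>R c a)) ` Dc a"
      using \<open>c a \<noteq> 0\<close> by (auto simp: T_regu_def \<kappa>_def scaleR_add_left divide_inverse)
    then have "penalty_field Df c Dc \<beta> \<rho> a = Df a + (\<lambda>A. A *v (\<kappa> *\<^sub>R c a)) ` Dc a"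
      unfolding penalty_field_def
      using convex_set_plus[OF convex(1) convex_linear_image[OF lin convex(2)]] by (simp add: convex_hull_eq)
    then obtain d A where d: "d \<in> Df a" and A: "A \<in> Dc a" and s_eq: "s = d + A *v (\<kappa> *\<^sub>R c a)"
      using s by (auto elim!: set_plus_elim)
    have "- (A *v c a) - (1 / \<kappa>) *\<^sub>R n = (1 / \<kappa>) *\<^sub>R d"
    proof -
      have "n = - d - \<kappa> *\<^sub>R (A *v c a)"
        using sn unfolding s_eq by (simp add: matrix_vector_mult_scaleR algebra_simps eq_neg_iff_add_eq_0)
      then show ?thesis
        using \<open>\<kappa> > 0\<close> by (simp add: scaleR_diff_right)
    qed
    then have "dist (- (A *v c a)) ((1 / \<kappa>) *\<^sub>R n) = norm d / \<kappa>"
      using \<open>\<kappa> > 0\<close> by (simp add: dist_norm)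
    moreover have "setdist {- (A *v c a) |A. A \<in> Dc a} (normal_cone X a) \<le> dist (- (A *v c a)) ((1 / \<kappa>) *\<^sub>R n)"
      using A normal_cone_scaleR[OF n, of "1 / \<kappa>"] \<open>\<kappa> > 0\<close> by (intro setdist_le_dist) auto
    moreover have "norm d / \<kappa> \<le> M / \<kappa>"
      using bound[OF d] \<open>\<kappa> > 0\<close> by (simp add: divide_right_mono)
    ultimately have "\<nu> * norm (c a) \<le> M / \<kappa>"
      using \<nu>(2) by linarith
    then have "\<nu> * norm (c a) * \<kappa> \<le> M"
      using \<open>\<kappa> > 0\<close> by (simp add: pos_le_divide_eq)
    moreover have "\<nu> * norm (c a) * \<kappa> = \<nu> * \<beta> + \<nu> * norm (c a) * \<rho>"
      using \<open>c a \<noteq> 0\<close> by (simp add: \<kappa>_def field_simps)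
    moreover have "\<nu> * norm (c a) * \<rho> \<ge> 0"
      using \<nu>(1) \<rho> by simp
    moreover have "M < \<nu> * \<beta>"
      using \<beta>(2) \<nu>(1) by (simp add: field_simps)
    ultimately show False
      by linarith
  qed
  have "convex (Df a + column_span (Dc a))"
    unfolding column_span_def by (intro convex_set_plus convex(1) subspace_imp_convex subspace_span)
  moreover have "Df a + {J *v (\<beta> *\<^sub>R u + \<rho> *\<^sub>R c a) |J u. J \<in> Dc a \<and> u \<in> T_regu (c a)}
      \<subseteq> Df a + column_span (Dc a)"
    unfolding column_span_def by (intro set_plus_mono2) (auto intro!: span_base)
  ultimately have "penalty_field Df c Dc \<beta> \<rho> a \<subseteq> Df a + column_span (Dc a)"
    unfolding penalty_field_def by (rule_tac hull_minimal)
  then have "0 \<in> Df a + column_span (Dc a) + normal_cone X a"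
    using s n sn by (metis set_plus_intro subsetD)
  then show ?thesis
    using \<open>a \<in> X\<close> feasible by (simp add: kkt_point_def)
qed

lemma tendsto_zero_if_zero_at_cluster_points:
  fixes x :: "nat \<Rightarrow> 'a::heine_borel" and h :: "'a \<Rightarrow> 'b::real_normed_vector"
  assumes x: "bounded (range x)" and h: "continuous_on UNIV h"
    and zero: "\<And>a. cluster_point x a \<Longrightarrow> h a = 0"
  shows "(\<lambda>k. h (x k)) \<longlonglongrightarrow> 0"
proof (rule ccontr)
  assume "\<not> ?thesis"
  then obtain \<epsilon> where \<epsilon>: "\<epsilon> > 0" "\<And>K. \<exists>k\<ge>K. \<epsilon> \<le> norm (h (x k))"
    unfolding lim_sequentially by (auto simp: not_less)
  obtain r where r: "strict_mono (r :: nat \<Rightarrow> nat)" "\<And>n. \<epsilon> \<le> norm (h (x (r n)))"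
    using strict_mono_selection[of "\<lambda>n k. \<epsilon> \<le> norm (h (x k))", OF \<epsilon>(2)] by blast
  have "bounded (range (x \<circ> r))"
    using x by (rule bounded_subset) auto
  then obtain a s where s: "strict_mono (s :: nat \<Rightarrow> nat)" "(x \<circ> r \<circ> s) \<longlonglongrightarrow> a"
    using bounded_imp_convergent_subsequence by blast
  then have "h a = 0"
    using zero[of a] strict_mono_o[OF r(1) s(1)] unfolding cluster_point_def by (metis o_assoc)
  have "(\<lambda>n. norm (h ((x \<circ> r \<circ> s) n))) \<longlonglongrightarrow> norm (h a)"
    by (intro tendsto_norm continuous_on_tendsto_compose[OF h s(2)]) auto
  then have "\<epsilon> \<le> norm (h a)"
    by (rule LIMSEQ_le_const) (use r(2) in auto)
  then show False
    using \<open>h a = 0\<close> \<epsilon>(1) by simp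
qed

lemma averaged_noise_vanishes:
  fixes \<xi> :: "nat \<Rightarrow> 'a::real_normed_vector"
  assumes \<eta>: "\<And>k. \<eta> k > 0" and time: "filterlim (step_time \<eta>) at_top sequentially"
    and noise: "(\<lambda>i. SUP j\<in>{i..step_index \<eta> (step_time \<eta> i + T)}. norm (\<Sum>k=i..j. \<eta> k *\<^sub>R \<xi> k)) \<longlonglongrightarrow> 0"
    and "\<epsilon> > 0"
  shows "\<exists>I. \<forall>i\<ge>I. \<forall>m\<ge>i. step_time \<eta> m \<le> step_time \<eta> i + T \<longrightarrow> norm (\<Sum>k=i..<m. \<eta> k *\<^sub>R \<xi> k) \<le> \<epsilon>"
proof -
  let ?S = "\<lambda>i. SUP j\<in>{i..step_index \<eta> (step_time \<eta> i + T)}. norm (\<Sum>k=i..j. \<eta> k *\<^sub>R \<xi> k)"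
  obtain I where I: "\<And>i. i \<ge> I \<Longrightarrow> ?S i < \<epsilon>"
    using order_tendstoD(2)[OF noise \<open>\<epsilon> > 0\<close>] unfolding eventually_sequentially by blast
  have "norm (\<Sum>k=i..<m. \<eta> k *\<^sub>R \<xi> k) \<le> \<epsilon>" if i: "i \<ge> I" and m: "m \<ge> i" "step_time \<eta> m \<le> step_time \<eta> i + T" for i m
  proof (cases "m = i")
    case True
    then show ?thesis
      using \<open>\<epsilon> > 0\<close> by simp
  next
    case False
    then obtain j where j: "m = Suc j" "i \<le> j"
      using m(1) by (cases m) auto
    then have "step_time \<eta> j \<le> step_time \<eta> i + T"
      using m(2) \<eta>[of j] by (simp add: step_time_Suc)
    then have "j \<in> {i..step_index \<eta> (step_time \<eta> i + T)}"
      using step_index_upper[OF time] j(2) by simp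
    then have "norm (\<Sum>k=i..j. \<eta> k *\<^sub>R \<xi> k) \<le> ?S i"
      by (intro cSUP_upper bounded_imp_bdd_above finite_imp_bounded) auto
    then show ?thesis
      using I[OF i] j by (simp add: atLeastLessThanSuc_atLeastAtMost)
  qed
  then show ?thesis
    by blast
qed

theorem theorem4p2:
  fixes X :: "(real^'n) set"
    and f :: "real^'n \<Rightarrow> real" and c :: "real^'n \<Rightarrow> real^'p"
    and Df :: "real^'n \<Rightarrow> (real^'n) set" and Dc :: "real^'n \<Rightarrow> (real^'p^'n) set"
    and \<beta> \<rho> \<theta>min \<theta>max :: real
    and \<eta> \<theta> \<delta> :: "nat \<Rightarrow> real"
    and d \<xi> x :: "nat \<Rightarrow> real^'n" and J :: "nat \<Rightarrow> real^'p^'n"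
    and w \<mu> :: "nat \<Rightarrow> real^'p"
  assumes "closed X" and "convex X" and "\<beta> > 0" and "\<rho> \<ge> 0"
    and f_path_diff: "conservative_field f Df" "\<forall>z. convex (Df z)"
    and c_path_diff: "conservative_jacobian c Dc" "\<forall>z. convex (Dc z)"
    and f_below: "bdd_below (f ` X)"
    and weak_sard: "interior (penalty f c \<beta> \<rho> ` critical_set X (penalty_field Df c Dc \<beta> \<rho>)) = {}"
    and iteration: "sgd_lalm X \<beta> \<rho> \<eta> \<theta> d J \<xi> x w \<mu>"
    and x_bounded: "range x \<subseteq> X" "bounded (range x)"
    and approximation: "\<forall>k. \<delta> k \<ge> 0" "\<delta> \<longlonglongrightarrow> 0"
      "\<forall>k. d k \<in> expansion (\<delta> k) Df (x k)"
      "\<forall>k. J k \<in> expansion (\<delta> k) Dc (x k)"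
      "\<forall>k. norm (w k - c (x k)) \<le> \<delta> k"
    and noise_bounded: "bounded (range (\<lambda>k. \<xi> (Suc k)))"
    and steps: "\<forall>k. \<eta> k > 0" "\<eta> \<longlonglongrightarrow> 0" "filterlim (step_time \<eta>) at_top sequentially"
    and noise: "\<forall>T>0. (\<lambda>i. SUP j\<in>{i..step_index \<eta> (step_time \<eta> i + T)}.
                     norm (\<Sum>k=i..j. \<eta> k *\<^sub>R \<xi> (Suc k))) \<longlonglongrightarrow> 0"
    and dual_steps: "0 < \<theta>min" "\<theta>min \<le> \<theta>max" "\<theta>max < \<beta>" "\<forall>k. \<theta>min \<le> \<theta> k \<and> \<theta> k \<le> \<theta>max"
  shows "((\<forall>a. cluster_point x a \<longrightarrow> a \<in> critical_set X (penalty_field Df c Dc \<beta> \<rho>)) \<and>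
          convergent (\<lambda>k. penalty f c \<beta> \<rho> (x k))) \<and>
         (\<forall>\<nu> Mf.
            \<nu> > 0 \<longrightarrow>
            (\<forall>z\<in>X. \<nu> * norm (c z) \<le> setdist {- (A *v c z) |A. A \<in> Dc z} (normal_cone X z)) \<longrightarrow>
            Mf-lipschitz_on UNIV f \<longrightarrow>
            (\<forall>z\<in>X. \<forall>v\<in>Df z. norm v \<le> Mf) \<longrightarrow>
            \<beta> > Mf / \<nu> \<longrightarrow>
            (\<forall>a. cluster_point x a \<longrightarrow> kkt_point X c Df Dc a) \<and>
            convergent (\<lambda>k. f (x k)))"
proof -
  have f_lip: "locally_lipschitz f" and c_lip: "locally_lipschitz c"
    using f_path_diff(1) c_path_diff(1) by (simp_all add: conservative_field_def conservative_jacobian_def)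
  have Df: "locally_bounded_map Df" "graph_closed Df" "\<And>z. Df z \<noteq> {}"
    using f_path_diff(1) by (simp_all add: conservative_field_def conservative_map_def)
  have Dc: "locally_bounded_map Dc" "graph_closed Dc" "\<And>z. Dc z \<noteq> {}"
    using c_path_diff(1) by (simp_all add: conservative_jacobian_def conservative_map_def)
  have x_in_X: "x k \<in> X" for k
    using x_bounded(1) by blast
  have c_cont: "(\<lambda>n. c (z n)) \<longlonglongrightarrow> c b" if "z \<longlonglongrightarrow> b" for z b
    using locally_lipschitz_continuous[OF c_lip] that by (auto intro: continuous_on_tendsto_compose)
  have w_c: "(\<lambda>k. w k - c (x k)) \<longlonglongrightarrow> 0"
    by (rule Lim_null_comparison[OF _ approximation(2)]) (simp add: approximation(5))
  have update: "\<mu> (Suc k) = \<mu> k + \<theta> k *\<^sub>R (regu (w (Suc k)) - (1 / \<beta>) *\<^sub>R \<mu> k)" for k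
    using iteration unfolding sgd_lalm_def by blast
  have rates: "\<theta>min \<le> \<theta> k" "\<theta> k \<le> \<theta>max" for k
    using dual_steps(4) by blast+

  \<comment> \<open>The projection residual, divided by the step size, is a bounded normal vector at the next iterate.
    Adding it to the search direction turns the projected scheme into an unconstrained one.\<close>
  define l where "l k = d k + J k *v (\<mu> k + \<rho> *\<^sub>R w k)" for k
  define n where "n k = (1 / \<eta> k) *\<^sub>R (x k - \<eta> k *\<^sub>R (l k + \<xi> (Suc k)) - x (Suc k))" for k
  define u where "u k = l k + n k" for k
  define Q where "Q z = penalty_field Df c Dc \<beta> \<rho> z + normal_cone X z" for z
  have prox: "x (Suc k) = closest_point X (x k - \<eta> k *\<^sub>R (l k + \<xi> (Suc k)))" for k
    using iteration unfolding sgd_lalm_def l_def by blast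
  have step: "x (Suc k) = x k - \<eta> k *\<^sub>R (u k + \<xi> (Suc k))" for k
    using steps(1)[rule_format, of k] by (simp add: u_def n_def algebra_simps)
  have "X \<noteq> {}"
    using x_in_X by blast
  have n_normal: "n k \<in> normal_cone X (x (Suc k))" for k
    unfolding n_def using closest_point_residual_normal[OF \<open>closed X\<close> \<open>convex X\<close> \<open>X \<noteq> {}\<close>]
      steps(1)[rule_format, of k] by (intro normal_cone_scaleR) (auto simp: prox)

  have d_bounded: "bounded (range d)"
    using approximation(3) by (intro expansion_bounded[OF Df x_bounded(2) approximation(2)]) blast
  have J_bounded: "bounded (range J)"
    using approximation(4) by (intro expansion_bounded[OF Dc x_bounded(2) approximation(2)]) blast
  have \<mu>_bounded: "bounded (range \<mu>)"
    by (rule multiplier_bounded[where y = w and \<theta> = \<theta> and \<beta> = \<beta>, OF update dual_steps(1,3) rates])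
  have w_bounded: "bounded (range w)"
  proof -
    have "compact (closure (range x))"
      using x_bounded(2) by (simp add: compact_closure)
    then have "bounded (c ` closure (range x))"
      using locally_lipschitz_continuous[OF c_lip]
      by (intro compact_imp_bounded compact_continuous_image) (auto intro: continuous_on_subset)
    then have "bounded (range (\<lambda>k. c (x k)))"
      by (rule bounded_subset) (use closure_subset in blast)
    moreover have "bounded (range (\<lambda>k. w k - c (x k)))"
      using w_c by (rule convergent_imp_bounded)
    ultimately have "bounded (range (\<lambda>k. c (x k) + (w k - c (x k))))"
      by (rule bounded_plus_comp)
    then show ?thesis
      by simp
  qed
  have l_bounded: "bounded (range l)"
  proof -
    have "bounded (range (\<lambda>k. \<mu> k + \<rho> *\<^sub>R w k))"
      by (rule bounded_plus_comp[OF \<mu>_bounded bounded_scaleR_comp[OF w_bounded]])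
    then obtain B C where B: "\<And>k. norm (J k) \<le> B" and C: "\<And>k. norm (\<mu> k + \<rho> *\<^sub>R w k) \<le> C"
      using J_bounded unfolding bounded_iff by blast
    obtain K where K: "K > 0" "\<And>(A :: real^'p^'n) y. norm (A *v y) \<le> norm A * norm y * K"
      using bounded_bilinear.pos_bounded[OF bounded_bilinear_matrix_vector_mult] by blast
    have "norm (J k *v (\<mu> k + \<rho> *\<^sub>R w k)) \<le> B * C * K" for k
    proof -
      have "norm (J k) * norm (\<mu> k + \<rho> *\<^sub>R w k) * K \<le> B * C * K"
        using B[of k] C[of k] K(1) order_trans[OF norm_ge_zero B[of k]] order_trans[OF norm_ge_zero C[of k]]
        by (intro mult_mono mult_nonneg_nonneg) auto
      then show ?thesis
        using K(2) order_trans by blast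
    qed
    then have "bounded (range (\<lambda>k. J k *v (\<mu> k + \<rho> *\<^sub>R w k)))"
      unfolding bounded_iff by blast
    then show ?thesis
      unfolding l_def by (rule bounded_plus_comp[OF d_bounded])
  qed
  obtain B where B: "\<And>k. norm (l k + \<xi> (Suc k)) \<le> B"
    using bounded_plus_comp[OF l_bounded noise_bounded] unfolding bounded_iff by blast
  have x_step: "norm (x (Suc k) - x k) \<le> \<eta> k * B" for k
  proof -
    have "dist (x (Suc k)) (closest_point X (x k)) \<le> norm (\<eta> k *\<^sub>R (l k + \<xi> (Suc k)))"
      using closest_point_lipschitz[OF \<open>convex X\<close> \<open>closed X\<close> \<open>X \<noteq> {}\<close>, of "x k - \<eta> k *\<^sub>R (l k + \<xi> (Suc k))" "x k"]
      unfolding prox by (simp add: dist_norm)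
    also have "\<dots> \<le> \<eta> k * B"
      using B[of k] steps(1)[rule_format, of k] by simp
    finally show ?thesis
      by (simp add: dist_norm closest_point_self[OF x_in_X])
  qed
  have n_bounded: "bounded (range n)"
  proof -
    have "norm (n k) \<le> B + B" for k
    proof -
      have \<eta>: "\<eta> k > 0"
        using steps(1) by blast
      have "n k = - (l k + \<xi> (Suc k)) - (1 / \<eta> k) *\<^sub>R (x (Suc k) - x k)"
        using \<eta> by (simp add: n_def algebra_simps)
      then have "norm (n k) \<le> norm (- (l k + \<xi> (Suc k))) + norm ((1 / \<eta> k) *\<^sub>R (x (Suc k) - x k))"
        by (metis norm_triangle_ineq4)
      moreover have "norm ((1 / \<eta> k) *\<^sub>R (x (Suc k) - x k)) \<le> B"
        using x_step[of k] \<eta> by (simp add: divide_simps mult.commute)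
      ultimately show ?thesis
        using B[of k] unfolding norm_minus_cancel by linarith
    qed
    then show ?thesis
      unfolding bounded_iff by blast
  qed
  have u_bounded: "bounded (range u)"
    unfolding u_def using l_bounded n_bounded by (rule bounded_plus_comp)
  have noise': "\<exists>I. \<forall>i\<ge>I. \<forall>m\<ge>i. step_time \<eta> m \<le> step_time \<eta> i + 1 \<longrightarrow>
      norm (\<Sum>k=i..<m. \<eta> k *\<^sub>R \<xi> (Suc k)) \<le> \<epsilon>" if "\<epsilon> > 0" for \<epsilon>
    using averaged_noise_vanishes[OF _ steps(3) noise[rule_format, OF zero_less_one] that] steps(1) by blast
  have difference: "(\<lambda>k. x (Suc k) - x k) \<longlonglongrightarrow> 0"
    by (rule Lim_null_comparison[OF _ tendsto_mult_left_zero[OF steps(2), of B]]) (simp add: x_step)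
  have limit: "q \<in> Q a" if r: "strict_mono r" and x_r: "(x \<circ> r) \<longlonglongrightarrow> a" and u_r: "(u \<circ> r) \<longlonglongrightarrow> q" for r a q
  proof -
    have "bounded (range (\<lambda>k. (d (r k), J (r k), \<mu> (r k))))"
      by (rule bounded_subset[OF bounded_Times[OF d_bounded bounded_Times[OF J_bounded \<mu>_bounded]]]) auto
    then obtain s p where s: "strict_mono (s :: nat \<Rightarrow> nat)"
      and p: "((\<lambda>k. (d (r k), J (r k), \<mu> (r k))) \<circ> s) \<longlonglongrightarrow> p"
      using bounded_imp_convergent_subsequence by blast
    define i where "i = r \<circ> s"
    have i: "strict_mono i" "filterlim i at_top sequentially"
      unfolding i_def using strict_mono_o[OF r s] by (auto intro: filterlim_subseq)
    obtain d' J' m' where p_eq: "p = (d', J', m')"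
      by (cases p) auto
    have d_i: "(\<lambda>k. d (i k)) \<longlonglongrightarrow> d'" and J_i: "(\<lambda>k. J (i k)) \<longlonglongrightarrow> J'" and \<mu>_i: "(\<lambda>k. \<mu> (i k)) \<longlonglongrightarrow> m'"
      using tendsto_fst[OF p] tendsto_fst[OF tendsto_snd[OF p]] tendsto_snd[OF tendsto_snd[OF p]]
      by (simp_all add: p_eq i_def o_def)
    have x_i: "(\<lambda>k. x (i k)) \<longlonglongrightarrow> a" and u_i: "(\<lambda>k. u (i k)) \<longlonglongrightarrow> q"
      using LIMSEQ_subseq_LIMSEQ[OF x_r s] LIMSEQ_subseq_LIMSEQ[OF u_r s] by (simp_all add: i_def o_def)
    have \<delta>_i: "(\<lambda>k. \<delta> (i k)) \<longlonglongrightarrow> 0"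
      by (rule filterlim_compose[OF approximation(2) i(2)])
    have delayed: "filterlim (\<lambda>k. i k - m) at_top sequentially" for m
      by (rule filterlim_compose[OF filterlim_minus_const_nat_at_top i(2)])
    \<comment> \<open>Truncated subtraction is harmless, because \<open>i k \<ge> m\<close> from some \<open>k\<close> on.\<close>
    have x_delayed: "(\<lambda>k. x (i k - m)) \<longlonglongrightarrow> a" for m
    proof (induction m)
      case (Suc m)
      have "(\<lambda>k. x (Suc (i k - Suc m)) - x (i k - Suc m)) \<longlonglongrightarrow> 0"
        by (rule filterlim_compose[OF difference delayed])
      moreover have "\<forall>\<^sub>F k in sequentially. Suc (i k - Suc m) = i k - m"
        using i(2)[unfolded filterlim_at_top, rule_format, of "Suc m"] by eventually_elim simp
      then have "\<forall>\<^sub>F k in sequentially. x (Suc (i k - Suc m)) - x (i k - Suc m) = x (i k - m) - x (i k - Suc m)"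
        by eventually_elim simp
      ultimately have "(\<lambda>k. x (i k - m) - x (i k - Suc m)) \<longlonglongrightarrow> 0"
        by (rule Lim_transform_eventually)
      from tendsto_diff[OF Suc this] show ?case
        by simp
    qed (simp add: x_i)
    have w_delayed: "(\<lambda>k. w (i k - m)) \<longlonglongrightarrow> c a" for m
      using tendsto_add[OF filterlim_compose[OF w_c delayed[of m]] c_cont[OF x_delayed[of m]]] by simp
    have "d' \<in> Df a"
      using approximation(3) by (intro expansion_limit[OF Df x_i \<delta>_i _ d_i]) blast
    moreover have "J' \<in> Dc a"
      using approximation(4) by (intro expansion_limit[OF Dc x_i \<delta>_i _ J_i]) blast
    moreover obtain u' where "u' \<in> T_regu (c a)" "m' = \<beta> *\<^sub>R u'"
      using multiplier_limit[where y = w and \<mu> = \<mu> and \<theta> = \<theta> and \<beta> = \<beta>, OF update dual_steps(1,3) rates i(1) w_delayed] \<mu>_i unfolding o_def by blast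
    ultimately have "d' + J' *v (m' + \<rho> *\<^sub>R c a) \<in>
        Df a + {J *v (\<beta> *\<^sub>R u + \<rho> *\<^sub>R c a) |J u. J \<in> Dc a \<and> u \<in> T_regu (c a)}"
      by (intro set_plus_intro) auto
    then have l_mem: "d' + J' *v (m' + \<rho> *\<^sub>R c a) \<in> penalty_field Df c Dc \<beta> \<rho> a"
      unfolding penalty_field_def by (rule hull_inc)
    have "(\<lambda>k. w (i k)) \<longlonglongrightarrow> c a"
      using w_delayed[of 0] by simp
    then have "(\<lambda>k. l (i k)) \<longlonglongrightarrow> d' + J' *v (m' + \<rho> *\<^sub>R c a)"
      unfolding l_def by (intro tendsto_intros tendsto_matrix_vector_mult d_i J_i \<mu>_i)
    from tendsto_diff[OF u_i this] have n_i: "(\<lambda>k. n (i k)) \<longlonglongrightarrow> q - (d' + J' *v (m' + \<rho> *\<^sub>R c a))"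
      by (simp add: u_def)
    have "(\<lambda>k. x (Suc (i k))) \<longlonglongrightarrow> a"
      using tendsto_add[OF filterlim_compose[OF difference i(2)] x_i] by simp
    then have "q - (d' + J' *v (m' + \<rho> *\<^sub>R c a)) \<in> normal_cone X a"
      by (rule normal_cone_limit[OF n_normal _ n_i])
    with l_mem have "(d' + J' *v (m' + \<rho> *\<^sub>R c a)) + (q - (d' + J' *v (m' + \<rho> *\<^sub>R c a))) \<in> Q a"
      unfolding Q_def by (rule set_plus_intro)
    then show ?thesis
      by simp
  qed
  interpret inclusion: perturbed_inclusion x u "\<lambda>k. \<xi> (Suc k)" \<eta> Q
  proof
    show "closed (Q z)" for z
      unfolding Q_def by (rule closed_penalty_plus_normal[OF f_path_diff(1) c_path_diff(1)])
    show "convex (Q z)" for z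
      unfolding Q_def penalty_field_def by (intro convex_set_plus convex_convex_hull convex_normal_cone)
  qed (use step steps x_bounded(2) u_bounded noise_bounded noise' limit in auto)
  interpret lyapunov: lyapunov_inclusion x u "\<lambda>k. \<xi> (Suc k)" \<eta> Q X "penalty f c \<beta> \<rho>"
  proof
    show "closed X" "x k \<in> X" for k
      by (fact, fact x_in_X)
    show "locally_lipschitz (penalty f c \<beta> \<rho>)"
      by (rule locally_lipschitz_penalty[OF f_lip c_lip])
    fix \<gamma> :: "real \<Rightarrow> real^'n" and L assume \<gamma>: "L-lipschitz_on UNIV \<gamma>" "range \<gamma> \<subseteq> X"
    obtain N where N: "negligible N" "\<And>t. t > 0 \<Longrightarrow> t \<notin> N \<Longrightarrow> \<exists>v. (\<gamma> has_vector_derivative v) (at t) \<and>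
        (\<forall>q\<in>penalty_field Df c Dc \<beta> \<rho> (\<gamma> t).
          ((\<lambda>t. penalty f c \<beta> \<rho> (\<gamma> t)) has_real_derivative q \<bullet> v) (at t))"
      using f_path_diff(1) c_path_diff(1) lipschitz_absolutely_continuous[OF \<gamma>(1)]
      by (rule penalty_chain_rule) (rule that)
    have "\<exists>v. (\<gamma> has_vector_derivative v) (at t) \<and>
        (\<forall>q\<in>Q (\<gamma> t). ((\<lambda>t. penalty f c \<beta> \<rho> (\<gamma> t)) has_real_derivative q \<bullet> v) (at t))"
      if t: "t > 0" "t \<notin> N" for t
    proof -
      obtain v where v: "(\<gamma> has_vector_derivative v) (at t)" and deriv:
        "\<And>q. q \<in> penalty_field Df c Dc \<beta> \<rho> (\<gamma> t) \<Longrightarrow>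
          ((\<lambda>t. penalty f c \<beta> \<rho> (\<gamma> t)) has_real_derivative q \<bullet> v) (at t)"
        using N(2)[OF t] by blast
      have "((\<lambda>t. penalty f c \<beta> \<rho> (\<gamma> t)) has_real_derivative q \<bullet> v) (at t)" if "q \<in> Q (\<gamma> t)" for q
      proof -
        obtain s n where "s \<in> penalty_field Df c Dc \<beta> \<rho> (\<gamma> t)" "n \<in> normal_cone X (\<gamma> t)" "q = s + n"
          using \<open>q \<in> Q (\<gamma> t)\<close> unfolding Q_def by (rule set_plus_elim) (rule that)
        then show ?thesis
          using deriv normal_orthogonal_to_velocity[OF \<gamma>(2) v] by (simp add: inner_add_left)
      qed
      then show ?thesis
        using v by blast
    qed
    then show "\<exists>N. negligible N \<and> (\<forall>t>0. t \<notin> N \<longrightarrow> (\<exists>v. (\<gamma> has_vector_derivative v) (at t) \<and>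
        (\<forall>q\<in>Q (\<gamma> t). ((\<lambda>t. penalty f c \<beta> \<rho> (\<gamma> t)) has_real_derivative q \<bullet> v) (at t))))"
      using N(1) by blast
  qed
  have critical: "critical_set X (penalty_field Df c Dc \<beta> \<rho>) = {z \<in> X. 0 \<in> Q z}"
    by (simp add: critical_set_def Q_def)
  have values_converge: "convergent (\<lambda>k. penalty f c \<beta> \<rho> (x k))"
    by (rule lyapunov.lyapunov_values_converge) (use weak_sard in \<open>simp add: critical\<close>)
  have cluster: "a \<in> critical_set X (penalty_field Df c Dc \<beta> \<rho>)" if "cluster_point x a" for a
  proof -
    obtain r where r: "strict_mono r" "(x \<circ> r) \<longlonglongrightarrow> a"
      using \<open>cluster_point x a\<close> unfolding cluster_point_def by blast
    have "a \<in> X"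
      using closed_sequentially[OF \<open>closed X\<close> _ r(2)] x_in_X by simp
    then show ?thesis
      using lyapunov.cluster_points_critical[OF values_converge r] by (simp add: critical)
  qed
  have kkt: "(\<forall>a. cluster_point x a \<longrightarrow> kkt_point X c Df Dc a) \<and> convergent (\<lambda>k. f (x k))"
    if "\<nu> > 0" and regular: "\<forall>z\<in>X. \<nu> * norm (c z) \<le> setdist {- (A *v c z) |A. A \<in> Dc z} (normal_cone X z)"
      and "\<forall>z\<in>X. \<forall>v\<in>Df z. norm v \<le> Mf" and "\<beta> > Mf / \<nu>" for \<nu> Mf
  proof -
    have kkt: "kkt_point X c Df Dc a" if "cluster_point x a" for a
    proof (rule critical_point_is_kkt)
      show "a \<in> critical_set X (penalty_field Df c Dc \<beta> \<rho>)"
        using that by (rule cluster)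
      then have "a \<in> X"
        by (simp add: critical_set_def)
      then show "\<nu> * norm (c a) \<le> setdist {- (A *v c a) |A. A \<in> Dc a} (normal_cone X a)"
        "\<And>v. v \<in> Df a \<Longrightarrow> norm v \<le> Mf"
        using regular \<open>\<forall>z\<in>X. \<forall>v\<in>Df z. norm v \<le> Mf\<close> by blast+
    qed (use f_path_diff(2) c_path_diff(2) \<open>\<rho> \<ge> 0\<close> \<open>\<nu> > 0\<close> \<open>\<beta> > 0\<close> \<open>\<beta> > Mf / \<nu>\<close> in blast)+
    have c_zero: "(\<lambda>k. c (x k)) \<longlonglongrightarrow> 0"
      by (rule tendsto_zero_if_zero_at_cluster_points[OF x_bounded(2) locally_lipschitz_continuous[OF c_lip]])
        (use kkt in \<open>simp add: kkt_point_def\<close>)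
    obtain g where "(\<lambda>k. penalty f c \<beta> \<rho> (x k)) \<longlonglongrightarrow> g"
      using values_converge unfolding convergent_def by blast
    then have "(\<lambda>k. penalty f c \<beta> \<rho> (x k) - \<beta> * norm (c (x k)) - \<rho> / 2 * (norm (c (x k)))\<^sup>2)
        \<longlonglongrightarrow> g - \<beta> * norm (0 :: real^'p) - \<rho> / 2 * (norm (0 :: real^'p))\<^sup>2"
      by (intro tendsto_intros c_zero)
    then have "(\<lambda>k. f (x k)) \<longlonglongrightarrow> g"
      by (simp add: penalty_def)
    then show ?thesis
      using kkt convergentI by blast
  qed
  show ?thesis
    using cluster values_converge kkt by blast
qed

end
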